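(* Let $A_1$ and $A_2$ be unital commutative real C$^*$-algebras and let $T:A_1\to A_2$ be an orthogonality preserving real-linear bijection. Then $T$ is continuous.
   Context: A real C$^*$-algebra is a real Banach $*$-algebra $A$ satisfying $\|a^*a\|=\|a\|^2$ for all $a\in A$ and such that $1+a^*a$ is invertible in the unitization of $A$ for every $a\in A$ (every complex C$^*$-algebra is one by restriction of scalars). Elements $a,b$ are orthogonal, $a\perp b$, if $ab^*=b^*a=0$ (in the commutative case this is equivalent to $ab=0$). A mapping $T$ is orthogonality preserving if $a\perp b$ implies $T(a)\perp T(b)$; no continuity of $T$ and no orthogonality preservation of $T^{-1}$ is assumed. *)

theory Defs
  imports "HOL-Analysis.Analysis"
begin

text \<open>
  The unitization of a real algebra \<open>A\<close> is the vector space \<open>A \<times> \<real>\<close>, where \<open>(a, s)\<close> stands for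
  \<open>a + s 1\<close>; its unit is \<open>(0, 1)\<close>.
\<close>

definition (in real_algebra) unitization_mult :: "'a \<times> real \<Rightarrow> 'a \<times> real \<Rightarrow> 'a \<times> real" where
  "unitization_mult u v =
     (fst u * fst v + snd u *\<^sub>R fst v + snd v *\<^sub>R fst u, snd u * snd v)"

definition (in real_algebra) unitization_invertible :: "'a \<times> real \<Rightarrow> bool" where
  "unitization_invertible u \<longleftrightarrow>
     (\<exists>v. unitization_mult u v = (0, 1) \<and> unitization_mult v u = (0, 1))"

class real_cstar_algebra = real_normed_algebra + banach +
  fixes star :: "'a \<Rightarrow> 'a"
  assumes star_add: "star (a + b) = star a + star b"
    and star_scaleR: "star (r *\<^sub>R a) = r *\<^sub>R star a"
    and star_mult: "star (a * b) = star b * star a"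
    and star_star: "star (star a) = a"
    and cstar_identity: "norm (star a * a) = (norm a)\<^sup>2"
    and one_plus_invertible: "unitization_invertible (star a * a, 1)"

text \<open>
  The unit comes from \<^class>\<open>comm_monoid_mult\<close>, which does not require \<open>0 \<noteq> 1\<close>, so the zero algebra
  is not excluded.
\<close>

class unital_comm_real_cstar_algebra = real_cstar_algebra + comm_monoid_mult
begin

subclass comm_ring
  by standard (rule distrib_right)

end

text \<open>
  The unitization is formed also when the algebra already has a unit. The condition is then
  equivalent to invertibility of \<open>1 + x\<close> in the algebra itself.
\<close>

lemma unitization_invertible_unital:
  fixes x :: "'a::{real_algebra, monoid_mult}"
  shows "unitization_invertible (x, 1) \<longleftrightarrow> (\<exists>y. (1 + x) * y = 1 \<and> y * (1 + x) = 1)"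
proof
  assume "unitization_invertible (x, 1)"
  then obtain z :: 'a and t where zt: "unitization_mult (x, 1) (z, t) = (0, 1)"
    "unitization_mult (z, t) (x, 1) = (0, 1)"
    unfolding unitization_invertible_def by auto
  then have "x * z + z + x = 0" "z * x + z + x = 0"
    by (auto simp: unitization_mult_def ac_simps)
  then have "(1 + x) * (1 + z) = 1 \<and> (1 + z) * (1 + x) = 1"
    by (simp add: distrib_left distrib_right ac_simps)
  then show "\<exists>y. (1 + x) * y = 1 \<and> y * (1 + x) = 1" by blast
next
  assume "\<exists>y. (1 + x) * y = 1 \<and> y * (1 + x) = 1"
  then obtain y where "(1 + x) * y = 1" "y * (1 + x) = 1" by blast
  then have y: "y + x * y = 1" "y + y * x = 1"
    by (simp_all add: distrib_left distrib_right)
  then have "x * (y - 1) + (y - 1) + x = 0" "(y - 1) * x + x + (y - 1) = 0"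
    by (simp_all add: right_diff_distrib left_diff_distrib algebra_simps)
  then have "unitization_mult (x, 1) (y - 1, 1) = (0, 1)"
    "unitization_mult (y - 1, 1) (x, 1) = (0, 1)"
    by (simp_all add: unitization_mult_def)
  then show "unitization_invertible (x, 1)"
    unfolding unitization_invertible_def by blast
qed

definition orthogonal_elements :: "'a::real_cstar_algebra \<Rightarrow> 'a \<Rightarrow> bool" where
  "orthogonal_elements a b \<longleftrightarrow> a * star b = 0 \<and> star b * a = 0"

definition orthogonality_preserving ::
    "('a::real_cstar_algebra \<Rightarrow> 'b::real_cstar_algebra) \<Rightarrow> bool" where
  "orthogonality_preserving T \<longleftrightarrow>
     (\<forall>a b. orthogonal_elements a b \<longrightarrow> orthogonal_elements (T a) (T b))"

instantiation complex :: unital_comm_real_cstar_algebra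
begin

definition star_complex :: "complex \<Rightarrow> complex" where
  "star_complex = cnj"

instance
proof
  fix a b :: complex and r :: real
  show "star (a + b) = star a + star b" "star (r *\<^sub>R a) = r *\<^sub>R star a"
    "star (a * b) = star b * star a" "star (star a) = a"
    by (simp_all add: star_complex_def)
  show "norm (star a * a) = (norm a)\<^sup>2"
    by (simp add: star_complex_def norm_mult power2_eq_square)
  have "1 + cnj a * a = complex_of_real (1 + (cmod a)\<^sup>2)"
    using complex_norm_square[of a] by (simp add: mult.commute)
  moreover have "1 + (cmod a)\<^sup>2 \<noteq> 0"
    using zero_le_power2[of "cmod a"] by linarith
  ultimately have "1 + cnj a * a \<noteq> 0"
    by (metis of_real_eq_0_iff)
  then show "unitization_invertible (star a * a, 1)"
    unfolding unitization_invertible_unital star_complex_def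
    by (intro exI[of _ "inverse (1 + cnj a * a)"]) simp
qed

end

end

theory Submission
  imports Defs "HOL-Computational_Algebra.Fundamental_Theorem_Algebra"
begin

text \<open>
  In a commutative algebra orthogonality of \<open>a\<close> and \<open>b\<close> means \<open>a * b = 0\<close>, so \<open>T\<close> is a separating map:
  \<open>a * b = 0\<close> implies \<open>T a * T b = 0\<close>. By the closed graph theorem it suffices that \<open>a\<^sub>n \<longlonglongrightarrow> 0\<close> and
  \<open>T a\<^sub>n \<longlonglongrightarrow> T f\<close> force \<open>f = 0\<close>. The argument replaces points of a spectrum by the ideal \<open>J\<close> of all
  multipliers \<open>s\<close> for which \<open>a \<mapsto> T (s * a)\<close> is bounded, and has three ingredients.

  First, \<open>J\<close> is essential: every \<open>f \<noteq> 0\<close> has some \<open>s \<in> J\<close> with \<open>s * f \<noteq> 0\<close>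
  (\<open>mult_bounded_essential\<close>). Otherwise no nonzero multiple of \<open>f\<close> lies in \<open>J\<close>. A nonzero multiple \<open>g\<close>
  whose multiples contain no orthogonal nonzero pair generates an ideal of dimension at most two, on
  which \<open>T\<close> is bounded; hence every nonzero multiple of \<open>f\<close> has two orthogonal nonzero multiples.
  Splitting again and again gives an orthogonal sequence in the unit ball on which \<open>T\<close> grows as fast as
  one likes, and summing a suitably weighted series of its terms contradicts \<open>\<parallel>a\<parallel> \<le> \<parallel>a + b\<parallel>\<close> for orthogonal
  \<open>a\<close>, \<open>b\<close> (\<open>orthogonal_sequence_bounded\<close>).

  Secondly, a bounded separating map \<open>S\<close> satisfies \<open>S (u * a) * S b = S a * S (u * b)\<close> for self-adjoint
  \<open>u\<close> (\<open>bounded_separating_balanced\<close>): the bilinear map \<open>(a, b) \<mapsto> S a * S b\<close> is concentrated on the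
  diagonal, and a fine partition of unity in the variable \<open>u\<close> makes this precise. Applied to
  \<open>S a = T (v * a)\<close> with \<open>v \<in> J\<close>, it gives the same identity for \<open>T\<close> itself and every
  self-adjoint \<open>u\<close> with \<open>u * v = u\<close>.

  For such \<open>u\<close>, put \<open>f\<^sub>n = f - a\<^sub>n\<close>. Then \<open>T (u * f\<^sub>n) * T g = T f\<^sub>n * T (u * g) \<longlonglongrightarrow> 0\<close>, while
  \<open>T (u * f\<^sub>n) \<longlonglongrightarrow> T (u * f)\<close> since \<open>u \<in> J\<close>. Surjectivity provides \<open>g\<close> with \<open>T g = 1\<close>, so
  \<open>T (u * f) = 0\<close>, and \<open>u * f = 0\<close> by injectivity. The elements \<open>u\<close> approximate all positive elements
  \<open>star s * s\<close> with \<open>s \<in> J\<close>, so \<open>J\<close> annihilates \<open>f\<close> and \<open>f = 0\<close>.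

  Thirdly, all of this needs the continuous functional calculus of a self-adjoint element \<open>x\<close>, which is
  built directly, without characters or a complexification. By Weierstrass approximation
  it comes down to \<open>\<parallel>p x\<parallel> \<le> max \<bar>p\<bar>\<close> over \<open>[- \<parallel>x\<parallel>, \<parallel>x\<parallel>]\<close> for real polynomials \<open>p\<close> (\<open>norm_peval_le\<close>), and
  that follows from two facts: a self-adjoint \<open>y\<close> of norm one has \<open>1 - y * y\<close> not invertible
  (\<open>not_unit_one_minus_square\<close>, the spectral radius formula in disguise), whereas a real polynomial
  without zeros in that interval is invertible at \<open>x\<close>, by its factorisation over the reals
  (\<open>unit_elt_peval\<close>).
\<close>

section \<open>Involution and orthogonality\<close>

lemma star_zero [simp]: "star (0::'a::real_cstar_algebra) = 0"
  using star_scaleR[of 0 "0::'a"] by simp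

lemma star_minus: "star (- a) = - star (a::'a::real_cstar_algebra)"
  using star_scaleR[of "-1" a] by simp

lemma star_diff: "star (a - b) = star a - star (b::'a::real_cstar_algebra)"
  using star_add[of a "- b"] by (simp add: star_minus)

lemma star_one [simp]: "star (1::'a::unital_comm_real_cstar_algebra) = 1"
  by (metis mult.right_neutral star_mult star_star)

lemma star_mult_self_eq_0_iff: "star a * a = 0 \<longleftrightarrow> a = (0::'a::real_cstar_algebra)"
  using cstar_identity[of a] by auto

lemma star_mult_self_right_eq_0: "a * star a = 0 \<Longrightarrow> a = (0::'a::real_cstar_algebra)"
  using star_mult_self_eq_0_iff[of "star a"] by (metis star_star star_zero)

lemma norm_star: "norm (star a) = norm (a::'a::real_cstar_algebra)"
proof -
  have *: "norm b \<le> norm (star b)" for b :: 'a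
  proof (cases "b = 0")
    case False
    have "norm b * norm b \<le> norm (star b) * norm b"
      using norm_mult_ineq[of "star b" b] by (simp add: cstar_identity power2_eq_square)
    with False show ?thesis by simp
  next
    case True
    then show ?thesis by (metis norm_ge_zero norm_zero)
  qed
  show ?thesis
    using *[of a] *[of "star a"] by (simp add: star_star)
qed

lemma norm_square_selfadjoint:
  fixes x :: "'a::real_cstar_algebra"
  assumes "star x = x"
  shows "norm (x * x) = (norm x)\<^sup>2"
  using cstar_identity[of x] assms by simp

text \<open>
  The element \<open>star a * a\<close> is self-adjoint with square zero, so the C*-identity applies twice.
\<close>

lemma square_zero_imp_zero:
  fixes a :: "'a::unital_comm_real_cstar_algebra"
  assumes "a * a = 0"
  shows "a = 0"
proof -
  have "star (star a * a) * (star a * a) = star a * star a * (a * a)"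
    by (simp add: star_mult star_star ac_simps)
  then show ?thesis
    using assms star_mult_self_eq_0_iff by (metis mult_zero_right)
qed

lemma star_mult_cancel:
  fixes a b :: "'a::unital_comm_real_cstar_algebra"
  assumes "star a * a * b = 0"
  shows "a * b = 0"
proof -
  have "star (a * b) * (a * b) = star b * (star a * a * b)"
    by (simp add: star_mult ac_simps)
  then show ?thesis
    using assms by (simp add: star_mult_self_eq_0_iff)
qed

lemma orthogonal_elements_iff:
  fixes a b :: "'a::unital_comm_real_cstar_algebra"
  shows "orthogonal_elements a b \<longleftrightarrow> a * b = 0"
proof -
  have "star (a * star b) * (a * star b) = (a * b) * star (a * b)"
    by (simp add: star_mult star_star ac_simps)
  then have "a * star b = 0 \<longleftrightarrow> a * b = 0"
    by (metis mult_zero_left star_mult_self_eq_0_iff star_mult_self_right_eq_0)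
  then show ?thesis
    by (simp add: orthogonal_elements_def mult.commute)
qed

text \<open>
  Multiplying \<open>a + b\<close> by \<open>star a\<close> removes \<open>b\<close> and leaves \<open>star a * a\<close>, whose norm is the square of that
  of \<open>a\<close>.
\<close>

lemma norm_orthogonal_summand_le:
  fixes a b :: "'a::unital_comm_real_cstar_algebra"
  assumes "a * b = 0"
  shows "norm a \<le> norm (a + b)"
proof (cases "a = 0")
  case False
  have "star a * b = 0"
    using assms orthogonal_elements_iff[of b a]
    by (simp add: orthogonal_elements_def mult.commute)
  then have "(norm a)\<^sup>2 = norm (star a * (a + b))"
    by (simp add: distrib_left cstar_identity)
  also have "\<dots> \<le> norm a * norm (a + b)"
    using norm_mult_ineq[of "star a" "a + b"] by (simp add: norm_star)
  finally show ?thesis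
    using False by (simp add: power2_eq_square)
qed simp

section \<open>Real polynomials at an element, and invertibility\<close>

text \<open>
  Horner evaluation with the real coefficients acting by scalar multiplication, which also makes sense
  in the zero algebra.
\<close>

definition peval :: "real poly \<Rightarrow> 'a::{real_algebra, monoid_mult} \<Rightarrow> 'a" where
  "peval p x = fold_coeffs (\<lambda>c y. c *\<^sub>R 1 + x * y) p 0"

lemma peval_0 [simp]: "peval 0 x = 0"
  by (simp add: peval_def)

lemma peval_pCons [simp]: "peval (pCons c p) x = c *\<^sub>R 1 + x * peval p x"
  by (cases "p = 0 \<and> c = 0") (auto simp: peval_def)

lemma peval_1 [simp]: "peval 1 x = 1"
  by (simp flip: pCons_one)

lemma peval_add: "peval (p + q) x = peval p x + peval q x"
  by (induction p q rule: poly_induct2) (auto simp: algebra_simps)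

lemma peval_smult: "peval (smult c p) x = c *\<^sub>R peval p x"
  by (induction p) (auto simp: algebra_simps)

lemma peval_diff: "peval (p - q) x = peval p x - peval q x"
  using peval_add[of "p - q" q x] by simp

lemma peval_mult: "peval (p * q) x = peval p x * peval q x"
  by (induction p) (auto simp: peval_add peval_smult algebra_simps)

text \<open>
  The complex numbers are one of the algebras in question, so complex roots of real polynomials can be
  handled with the homomorphism laws above.
\<close>

lemma peval_complex: "peval p z = poly (map_poly complex_of_real p) z"
  by (induction p) (auto simp: scaleR_conv_of_real map_poly_pCons)

lemma peval_of_real: "peval p (complex_of_real t) = of_real (poly p t)"
  by (induction p) (auto simp: scaleR_conv_of_real)

lemma peval_linear: "peval [:- t, 1:] x = x - t *\<^sub>R 1"
  by simp

lemma star_peval: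
  fixes x :: "'a::unital_comm_real_cstar_algebra"
  assumes "star x = x"
  shows "star (peval p x) = peval p x"
  by (induction p) (auto simp: star_add star_scaleR star_mult assms mult.commute)

definition unit_elt :: "'a::monoid_mult \<Rightarrow> bool" where
  "unit_elt a \<longleftrightarrow> (\<exists>b. a * b = 1)"

lemma unit_elt_mult:
  fixes a b :: "'a::comm_monoid_mult"
  shows "unit_elt (a * b) \<longleftrightarrow> unit_elt a \<and> unit_elt b"
proof
  assume "unit_elt (a * b)"
  then show "unit_elt a \<and> unit_elt b"
    unfolding unit_elt_def by (metis mult.assoc mult.commute)
next
  assume "unit_elt a \<and> unit_elt b"
  then obtain c d where "a * c = 1" "b * d = 1"
    unfolding unit_elt_def by blast
  then have "(a * b) * (c * d) = 1"
    by (metis mult.assoc mult.commute mult.left_neutral)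
  then show "unit_elt (a * b)"
    unfolding unit_elt_def by blast
qed

lemma unit_elt_scaleR:
  fixes a :: "'a::{real_algebra, monoid_mult}"
  assumes "c \<noteq> 0" "unit_elt a"
  shows "unit_elt (c *\<^sub>R a)"
proof -
  obtain b where "a * b = 1" using assms unfolding unit_elt_def by blast
  then have "(c *\<^sub>R a) * (inverse c *\<^sub>R b) = 1"
    using assms by simp
  then show ?thesis unfolding unit_elt_def by blast
qed

text \<open>
  The inverse is the fixed point of the contraction \<open>y \<mapsto> 1 + x * y\<close>.
\<close>

lemma unit_elt_one_minus:
  fixes x :: "'a::unital_comm_real_cstar_algebra"
  assumes "norm x < 1"
  shows "unit_elt (1 - x)"
proof -
  have "\<exists>!y. 1 + x * y = y"
  proof (rule banach_fix_type)
    show "\<forall>y z. dist (1 + x * y) (1 + x * z) \<le> norm x * dist y z"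
      by (simp add: dist_norm norm_mult_ineq flip: right_diff_distrib)
  qed (use assms in auto)
  then obtain y where "1 + x * y = y" by blast
  then have "(1 - x) * y = 1"
    by (simp add: left_diff_distrib) (metis add_diff_cancel_right')
  then show ?thesis unfolding unit_elt_def by blast
qed

lemma unit_elt_linear:
  fixes x :: "'a::unital_comm_real_cstar_algebra"
  assumes "norm x < \<bar>t\<bar>"
  shows "unit_elt (x - t *\<^sub>R 1)"
proof -
  have "t \<noteq> 0" using assms by auto
  have "norm (inverse t *\<^sub>R x) < 1"
    using assms norm_ge_zero[of x] by (simp add: divide_simps)
  then have "unit_elt ((- t) *\<^sub>R (1 - inverse t *\<^sub>R x))"
    using assms by (intro unit_elt_scaleR unit_elt_one_minus) auto
  moreover have "(- t) *\<^sub>R (1 - inverse t *\<^sub>R x) = x - t *\<^sub>R 1"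
    using \<open>t \<noteq> 0\<close> by (simp add: scaleR_diff_right)
  ultimately show ?thesis by simp
qed

lemma unit_elt_one_plus_square:
  fixes x :: "'a::unital_comm_real_cstar_algebra"
  assumes "star x = x"
  shows "unit_elt (1 + x * x)"
  using one_plus_invertible[of x] assms
  unfolding unitization_invertible_unital unit_elt_def by auto

text \<open>
  The polynomial is \<open>(x - a)\<^sup>2 + b\<^sup>2\<close>, and it becomes \<open>1 + y * y\<close> with self-adjoint
  \<open>y = (x - a) / b\<close> after division by \<open>b\<^sup>2\<close>.
\<close>

lemma unit_elt_quadratic:
  fixes x :: "'a::unital_comm_real_cstar_algebra"
  assumes "star x = x" "b \<noteq> 0"
  shows "unit_elt (peval [:a\<^sup>2 + b\<^sup>2, - 2 * a, 1:] x)"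
proof -
  define y where "y = peval [:- a / b, 1 / b:] x"
  have "star y = y" using assms by (simp add: y_def star_peval del: peval_pCons)
  then have "unit_elt (b\<^sup>2 *\<^sub>R (1 + y * y))"
    using assms by (intro unit_elt_scaleR unit_elt_one_plus_square) auto
  moreover have "b\<^sup>2 *\<^sub>R (1 + y * y) = peval (smult (b\<^sup>2) (1 + [:- a / b, 1 / b:] * [:- a / b, 1 / b:])) x"
    unfolding y_def peval_smult peval_add peval_mult peval_1 ..
  moreover have "smult (b\<^sup>2) (1 + [:- a / b, 1 / b:] * [:- a / b, 1 / b:]) = [:a\<^sup>2 + b\<^sup>2, - 2 * a, 1:]"
    using assms by (simp add: power2_eq_square field_simps flip: pCons_one)
  ultimately show ?thesis by metis
qed

lemma real_poly_quadratic_factor: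
  fixes q :: "real poly"
  assumes "poly (map_poly complex_of_real q) z = 0" "Im z \<noteq> 0"
  shows "[:(Re z)\<^sup>2 + (Im z)\<^sup>2, - 2 * Re z, 1:] dvd q"
proof -
  define d where "d = [:(Re z)\<^sup>2 + (Im z)\<^sup>2, - 2 * Re z, 1:]"
  define r where "r = q mod d"
  have "degree r < 2"
    using degree_mod_less'[of d q] by (cases "r = 0") (auto simp: d_def r_def)
  then obtain a b where r: "r = [:a, b:]"
    by (metis (no_types, opaque_lifting) One_nat_def degree_eq_zeroE degree_pCons_eq_if
        less_2_cases numeral_2_eq_2 not_less_eq pCons_cases less_Suc0 lessI pCons_0_0 degree_0)
  have "peval d z = 0"
    by (simp add: d_def complex_eq_iff power2_eq_square algebra_simps)
  moreover have "peval q z = peval (q div d) z * peval d z + peval r z"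
    by (metis div_mult_mod_eq peval_add peval_mult r_def)
  ultimately have "peval r z = 0"
    using assms by (simp add: peval_complex)
  then have "a + b * Re z = 0" "b * Im z = 0"
    by (simp_all add: r complex_eq_iff mult.commute)
  then have "r = 0" using assms r by simp
  then show ?thesis
    by (simp add: r_def d_def mod_eq_0_iff_dvd)
qed

text \<open>
  Over the reals the polynomial splits into constants, linear factors \<open>x - t\<close> with \<open>\<bar>t\<bar> > norm x\<close> and quadratic
  factors without real zeros. All of them are invertible: the linear ones by the contraction argument,
  the quadratic ones by the axiom on \<open>1 + star a * a\<close>.
\<close>

lemma unit_elt_peval:
  fixes x :: "'a::unital_comm_real_cstar_algebra"
  assumes "star x = x" "\<And>t. \<bar>t\<bar> \<le> norm x \<Longrightarrow> poly q t \<noteq> 0"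
  shows "unit_elt (peval q x)"
  using assms(2)
proof (induction "degree q" arbitrary: q rule: less_induct)
  case less
  have "q \<noteq> 0" using less.prems[of 0] by auto
  show ?case
  proof (cases "degree q = 0")
    case True
    then obtain c where "q = [:c:]" by (metis degree_eq_zeroE)
    then show ?thesis
      using \<open>q \<noteq> 0\<close> unit_elt_scaleR[of c "1::'a"] unit_elt_def[of "1::'a"] by auto
  next
    case False
    then have "\<not> constant (poly (map_poly complex_of_real q))"
      by (simp add: constant_degree degree_map_poly)
    then obtain z where z: "poly (map_poly complex_of_real q) z = 0"
      using fundamental_theorem_of_algebra by blast
    have *: ?thesis if "q = d * k" "degree d > 0" "unit_elt (peval d x)" for d k
    proof -
      have "k \<noteq> 0" "d \<noteq> 0" using that \<open>q \<noteq> 0\<close> by auto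
      then have "degree k < degree q" using that by (simp add: degree_mult_eq)
      then have "unit_elt (peval k x)"
        using less that by (metis mult_zero_right poly_mult)
      then show ?thesis using that by (simp add: peval_mult unit_elt_mult)
    qed
    show ?thesis
    proof (cases "Im z = 0")
      case True
      then have "z = of_real (Re z)" by (simp add: complex_eq_iff)
      then have "poly q (Re z) = 0"
        using z by (metis peval_complex peval_of_real of_real_eq_0_iff)
      then obtain k where "q = [:- Re z, 1:] * k"
        by (auto simp: poly_eq_0_iff_dvd dvd_def)
      moreover have "unit_elt (peval [:- Re z, 1:] x)"
        using less.prems[of "Re z"] \<open>poly q (Re z) = 0\<close> unit_elt_linear[of x "Re z"]
        by (metis peval_linear not_le)
      ultimately show ?thesis by (intro *[of "[:- Re z, 1:]" k]) (simp_all del: peval_pCons)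
    next
      case False
      then obtain k where "q = [:(Re z)\<^sup>2 + (Im z)\<^sup>2, - 2 * Re z, 1:] * k"
        using real_poly_quadratic_factor[OF z] by (auto simp: dvd_def)
      then show ?thesis
        using unit_elt_quadratic[OF assms(1) False, of "Re z"]
        by (intro *[of "[:(Re z)\<^sup>2 + (Im z)\<^sup>2, - 2 * Re z, 1:]" k]) (simp_all del: peval_pCons)
    qed
  qed
qed

section \<open>Spectral radius of a self-adjoint element\<close>

lemma norm_one_le: "norm (1::'a::unital_comm_real_cstar_algebra) \<le> 1"
proof -
  have "norm (1::'a) * norm (1::'a) = norm (1::'a)"
    using cstar_identity[of "1::'a"] by (simp add: power2_eq_square)
  then show ?thesis by (metis mult_cancel_right2 order.refl zero_le_one)
qed

text \<open>
  Only meaningful for arguments satisfying \<^const>\<open>unit_elt\<close>.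
\<close>

definition inv_elt :: "'a::monoid_mult \<Rightarrow> 'a" where
  "inv_elt a = (SOME b. a * b = 1)"

lemma mult_inv_elt: "unit_elt a \<Longrightarrow> a * inv_elt a = 1"
  unfolding unit_elt_def inv_elt_def by (rule someI_ex)

lemma inv_elt_unique:
  fixes a b :: "'a::comm_monoid_mult"
  assumes "a * b = 1"
  shows "inv_elt a = b"
proof -
  have "unit_elt a" using assms unfolding unit_elt_def by blast
  then have "a * inv_elt a = 1" by (rule mult_inv_elt)
  then show ?thesis
    using assms by (metis mult.assoc mult.commute mult.left_neutral)
qed

text \<open>
  From \<open>z\<inverse> - w\<inverse> = z\<inverse> * w\<inverse> * (w - z)\<close> one first reads off that \<open>z\<inverse>\<close> stays bounded near \<open>w\<close>, and
  then that it converges to \<open>w\<inverse>\<close>.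
\<close>

lemma continuous_on_inv_elt:
  fixes D :: "'c::metric_space \<Rightarrow> 'a::unital_comm_real_cstar_algebra"
  assumes D: "continuous_on S D" and unit: "\<And>z. z \<in> S \<Longrightarrow> unit_elt (D z)"
  shows "continuous_on S (\<lambda>z. inv_elt (D z))"
  unfolding continuous_on_def
proof
  fix w assume w: "w \<in> S"
  define k where "k = norm (inv_elt (D w))"
  have tD: "((\<lambda>z. norm (D z - D w)) \<longlongrightarrow> 0) (at w within S)"
    using D w by (simp add: continuous_on_def tendsto_norm_zero LIM_zero)
  have "((\<lambda>z. k * norm (D z - D w)) \<longlongrightarrow> k * 0) (at w within S)"
    by (intro tendsto_intros tD)
  then have ev1: "\<forall>\<^sub>F z in at w within S. k * norm (D z - D w) < 1/2"
    by (rule order_tendstoD) simp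
  have bnd: "norm (inv_elt (D z) - inv_elt (D w)) \<le> 2 * k * k * norm (D z - D w)"
    if "k * norm (D z - D w) < 1/2" "z \<in> S" for z
  proof -
    have "inv_elt (D z) - inv_elt (D w)
        = inv_elt (D z) * (D w * inv_elt (D w)) - inv_elt (D w) * (D z * inv_elt (D z))"
      by (simp add: mult_inv_elt unit w \<open>z \<in> S\<close>)
    also have "\<dots> = inv_elt (D z) * inv_elt (D w) * (D w - D z)"
      by (simp add: algebra_simps)
    finally have "inv_elt (D z) - inv_elt (D w) = inv_elt (D z) * inv_elt (D w) * (D w - D z)" .
    then have *: "norm (inv_elt (D z) - inv_elt (D w)) \<le> norm (inv_elt (D z)) * (k * norm (D z - D w))"
      by (smt (verit) k_def mult.assoc mult_right_mono norm_ge_zero norm_minus_commute norm_mult_ineq)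
    also have "\<dots> \<le> norm (inv_elt (D z)) * (1/2)"
      using that by (intro mult_left_mono) auto
    finally have "norm (inv_elt (D z)) \<le> 2 * k"
      using norm_triangle_sub[of "inv_elt (D z)" "inv_elt (D w)"] by (simp add: k_def)
    then have "norm (inv_elt (D z)) * (k * norm (D z - D w)) \<le> 2 * k * (k * norm (D z - D w))"
      by (intro mult_right_mono) (auto simp: k_def)
    with * show ?thesis by (simp add: mult.assoc)
  qed
  have "((\<lambda>z. 2 * k * k * norm (D z - D w)) \<longlongrightarrow> 2 * k * k * 0) (at w within S)"
    by (intro tendsto_intros tD)
  then have lim: "((\<lambda>z. 2 * k * k * norm (D z - D w)) \<longlongrightarrow> 0) (at w within S)" by simp
  have "\<forall>\<^sub>F z in at w within S. z \<in> S"
    by (simp add: eventually_at_filter)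
  with ev1 have "\<forall>\<^sub>F z in at w within S. norm (inv_elt (D z) - inv_elt (D w)) \<le> 2 * k * k * norm (D z - D w)"
    by eventually_elim (rule bnd)
  then have "((\<lambda>z. inv_elt (D z) - inv_elt (D w)) \<longlongrightarrow> 0) (at w within S)"
    by (rule Lim_null_comparison[OF _ lim])
  then show "((\<lambda>z. inv_elt (D z)) \<longlongrightarrow> inv_elt (D w)) (at w within S)"
    by (rule LIM_zero_cancel)
qed

text \<open>
  For complex \<open>z\<close> the real part of \<open>(1 - z x)\<inverse>\<close>, computed as
  \<open>(1 - Re z x) / \<bar>1 - z x\<bar>\<^sup>2\<close>, is an expression in \<open>x\<close> with real coefficients, so it makes sense in a real
  algebra. Its numerator and denominator are the following two polynomials.
\<close>

definition resolvent_num :: "complex \<Rightarrow> real poly" where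
  "resolvent_num z = [:1, - Re z:]"

definition resolvent_den :: "complex \<Rightarrow> real poly" where
  "resolvent_den z = [:1, - 2 * Re z, (cmod z)\<^sup>2:]"

definition re_resolvent :: "'a \<Rightarrow> complex \<Rightarrow> 'a::unital_comm_real_cstar_algebra" where
  "re_resolvent x z = peval (resolvent_num z) x * inv_elt (peval (resolvent_den z) x)"

lemma Re_square: "Re (z * z) = 2 * (Re z)\<^sup>2 - (cmod z)\<^sup>2"
  using cmod_power2[of z] by (simp add: power2_eq_square)

lemma resolvent_den_square:
  fixes x :: "'a::unital_comm_real_cstar_algebra"
  shows "peval (resolvent_den (z * z)) (x * x) = peval (resolvent_den z) x * peval (resolvent_den (- z)) x"
proof -
  have "resolvent_den z * resolvent_den (- z) = [:1, 0, - 2 * Re (z * z), 0, (cmod (z * z))\<^sup>2:]"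
    unfolding Re_square by (simp add: resolvent_den_def norm_mult power2_eq_square algebra_simps)
  then have "peval (resolvent_den z) x * peval (resolvent_den (- z)) x = peval [:1, 0, - 2 * Re (z * z), 0, (cmod (z * z))\<^sup>2:] x"
    by (metis peval_mult)
  then show ?thesis
    by (simp add: resolvent_den_def mult.assoc del: times_complex.sel)
qed

text \<open>
  The real part of the partial fraction identity
  \<open>(1 - z x)\<inverse> + (1 + z x)\<inverse> = 2 (1 - z\<^sup>2 x\<^sup>2)\<inverse>\<close>.
\<close>

lemma re_resolvent_square:
  fixes x :: "'a::unital_comm_real_cstar_algebra"
  assumes "unit_elt (peval (resolvent_den z) x)" "unit_elt (peval (resolvent_den (- z)) x)"
  shows "re_resolvent (x * x) (z * z) = (1/2) *\<^sub>R (re_resolvent x z + re_resolvent x (- z))"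
proof -
  let ?D = "\<lambda>z. peval (resolvent_den z) x" and ?N = "\<lambda>z. peval (resolvent_num z) x"
  define I where "I = inv_elt (?D z)"
  define J where "J = inv_elt (?D (- z))"
  have I: "?D z * I = 1" and J: "?D (- z) * J = 1"
    using assms by (simp_all add: I_def J_def mult_inv_elt)
  have inv: "inv_elt (peval (resolvent_den (z * z)) (x * x)) = I * J"
    unfolding resolvent_den_square
    by (rule inv_elt_unique) (metis I J mult.assoc mult.commute mult.left_neutral)
  have "resolvent_num z * resolvent_den (- z) + resolvent_num (- z) * resolvent_den z = smult 2 [:1, 0, - Re (z * z):]"
    unfolding Re_square by (simp add: resolvent_den_def resolvent_num_def power2_eq_square algebra_simps)
  then have "?N z * ?D (- z) + ?N (- z) * ?D z = 2 *\<^sub>R peval [:1, 0, - Re (z * z):] x"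
    by (metis peval_mult peval_add peval_smult)
  moreover have "peval [:1, 0, - Re (z * z):] x = peval (resolvent_num (z * z)) (x * x)"
    by (simp add: resolvent_num_def mult.assoc del: times_complex.sel)
  ultimately have "2 *\<^sub>R re_resolvent (x * x) (z * z) = (?N z * ?D (- z) + ?N (- z) * ?D z) * (I * J)"
    by (simp add: re_resolvent_def inv)
  also have "\<dots> = ?N z * I * (?D (- z) * J) + ?N (- z) * J * (?D z * I)"
    by (simp add: algebra_simps)
  also have "\<dots> = re_resolvent x z + re_resolvent x (- z)"
    by (simp add: I J) (simp add: re_resolvent_def I_def J_def)
  finally have "2 *\<^sub>R re_resolvent (x * x) (z * z) = re_resolvent x z + re_resolvent x (- z)" .
  then have "(1/2) *\<^sub>R 2 *\<^sub>R re_resolvent (x * x) (z * z) = (1/2) *\<^sub>R (re_resolvent x z + re_resolvent x (- z))" by simp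
  then show ?thesis by simp
qed

text \<open>
  The number \<open>l\<close> is the radius of a circle inside the unit circle, and \<open>e\<close> bounds the change of the
  resolvent between the two circles.
\<close>

definition resolvent_close :: "real \<Rightarrow> real \<Rightarrow> 'a::unital_comm_real_cstar_algebra \<Rightarrow> bool" where
  "resolvent_close e l x \<longleftrightarrow> (\<forall>z. cmod z \<le> 1 \<longrightarrow> unit_elt (peval (resolvent_den z) x)) \<and>
     (\<forall>z. cmod z = 1 \<longrightarrow> norm (re_resolvent x z - re_resolvent x (l *\<^sub>R z)) \<le> e)"

text \<open>
  Every point of the unit circle is a square \<open>z * z\<close>, and the values at \<open>z * z\<close> for \<open>x * x\<close> are averages of the
  values at \<open>z\<close> and \<open>- z\<close> for \<open>x\<close>. So the bound \<open>e\<close> is inherited while the radius \<open>l\<close> is squared.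
\<close>

lemma resolvent_close_square:
  fixes x :: "'a::unital_comm_real_cstar_algebra"
  assumes x: "resolvent_close e l x" and l: "\<bar>l\<bar> \<le> 1"
  shows "resolvent_close e (l * l) (x * x)"
proof -
  have unit: "unit_elt (peval (resolvent_den z) x)" if "cmod z \<le> 1" for z
    using x that by (simp add: resolvent_close_def)
  have close: "norm (re_resolvent x z - re_resolvent x (l *\<^sub>R z)) \<le> e" if "cmod z = 1" for z
    using x that by (simp add: resolvent_close_def)
  have "unit_elt (peval (resolvent_den w) (x * x))" if "cmod w \<le> 1" for w
  proof -
    define z where "z = csqrt w"
    have z: "z * z = w" by (simp add: z_def flip: power2_eq_square)
    have "cmod z \<le> 1" using that by (simp add: z_def)
    then show ?thesis
      using unit[of z] unit[of "- z"] by (simp add: resolvent_den_square unit_elt_mult flip: z)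
  qed
  moreover have "norm (re_resolvent (x * x) w - re_resolvent (x * x) ((l * l) *\<^sub>R w)) \<le> e" if "cmod w = 1" for w
  proof -
    define z where "z = csqrt w"
    have z: "z * z = w" by (simp add: z_def flip: power2_eq_square)
    have cz: "cmod z = 1" using that by (simp add: z_def)
    have "(l * l) *\<^sub>R w = (l *\<^sub>R z) * (l *\<^sub>R z)" by (simp flip: z)
    then have "re_resolvent (x * x) w - re_resolvent (x * x) ((l * l) *\<^sub>R w)
        = (1/2) *\<^sub>R (re_resolvent x z + re_resolvent x (- z)) - (1/2) *\<^sub>R (re_resolvent x (l *\<^sub>R z) + re_resolvent x (- (l *\<^sub>R z)))"
      using cz l by (simp only: flip: z) (intro arg_cong2[of _ _ _ _ minus] re_resolvent_square unit, auto)
    also have "\<dots> = (1/2) *\<^sub>R ((re_resolvent x z - re_resolvent x (l *\<^sub>R z)) + (re_resolvent x (- z) - re_resolvent x (l *\<^sub>R (- z))))"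
      by (simp add: algebra_simps)
    finally show ?thesis
      using norm_triangle_ineq[of "re_resolvent x z - re_resolvent x (l *\<^sub>R z)" "re_resolvent x (- z) - re_resolvent x (l *\<^sub>R (- z))"]
        close[of z] close[of "- z"] cz by simp
  qed
  ultimately show ?thesis by (simp add: resolvent_close_def)
qed

lemma re_resolvent_of_real:
  fixes x :: "'a::unital_comm_real_cstar_algebra"
  assumes "unit_elt (1 - t *\<^sub>R x)"
  shows "re_resolvent x (of_real t) = inv_elt (1 - t *\<^sub>R x)"
proof -
  define a where "a = 1 - t *\<^sub>R x"
  define b where "b = inv_elt a"
  have ab: "a * b = 1" using mult_inv_elt assms by (simp add: a_def b_def)
  have num: "peval (resolvent_num (of_real t)) x = a"
    by (simp add: resolvent_num_def a_def)
  have den: "peval (resolvent_den (of_real t)) x = a * a"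
    using scaleR_left_distrib[of t t x]
    by (simp add: resolvent_den_def a_def power2_eq_square algebra_simps)
  have "(a * a) * (b * b) = 1"
    using ab by (metis mult.assoc mult.commute mult.left_neutral)
  then have "inv_elt (a * a) = b * b" by (rule inv_elt_unique)
  then have "re_resolvent x (of_real t) = a * (b * b)"
    by (simp add: re_resolvent_def num den)
  also have "\<dots> = b" using ab by (simp flip: mult.assoc)
  finally show ?thesis by (simp add: a_def b_def)
qed

text \<open>
  At radius \<open>l \<le> 1/4\<close> the resolvent \<open>(1 - l y)\<inverse>\<close> is within \<open>1/3\<close> of \<open>1\<close>, so by closeness \<open>(1 - y)\<inverse>\<close> is within
  \<open>1/10 + 1/3 < 1/2\<close> of \<open>1\<close>. Writing \<open>(1 - y)\<inverse> = 1 + c\<close> gives \<open>y = c - c * y\<close>, hence \<open>norm y \<le> 2 * norm c < 1\<close>.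
\<close>

lemma not_resolvent_close:
  fixes y :: "'a::unital_comm_real_cstar_algebra"
  assumes y: "norm y = 1" and l: "0 \<le> l" "l \<le> 1/4"
  shows "\<not> resolvent_close (1/10) l y"
proof
  assume close: "resolvent_close (1/10) l y"
  have "peval (resolvent_den 1) y = (1 - y) * (1 - y)"
    by (simp add: resolvent_den_def algebra_simps scaleR_2)
  then have u1: "unit_elt (1 - y)"
    using close by (metis norm_one order.refl resolvent_close_def unit_elt_mult)
  have ul: "unit_elt (1 - l *\<^sub>R y)"
    using y l by (intro unit_elt_one_minus) auto
  define a where "a = inv_elt (1 - y)"
  define b where "b = inv_elt (1 - l *\<^sub>R y)"
  have "norm (re_resolvent y 1 - re_resolvent y (l *\<^sub>R 1)) \<le> 1/10"
    using close unfolding resolvent_close_def by (metis norm_one)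
  moreover have "l *\<^sub>R (1::complex) = of_real l"
    by (simp add: scaleR_conv_of_real)
  ultimately have ab: "norm (a - b) \<le> 1/10"
    using re_resolvent_of_real[of 1 y] re_resolvent_of_real[of l y] u1 ul by (simp add: a_def b_def)
  have a: "(1 - y) * a = 1" and b: "(1 - l *\<^sub>R y) * b = 1"
    using u1 ul by (simp_all add: a_def b_def mult_inv_elt)
  have b1: "b = 1 + l *\<^sub>R (y * b)" using b by (simp add: left_diff_distrib algebra_simps)
  have "norm (y * b) \<le> norm b" using norm_mult_ineq[of y b] y by simp
  then have lyb: "norm (l *\<^sub>R (y * b)) \<le> 1/4 * norm b"
    using l mult_mono[of l "1/4" "norm (y * b)" "norm b"] by simp
  then have "norm b \<le> 1 + 1/4 * norm b"
    using b1 norm_triangle_ineq[of 1 "l *\<^sub>R (y * b)"] norm_one_le[where 'a='a] by simp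
  moreover have "b - 1 = l *\<^sub>R (y * b)"
    using b1 by (metis add_diff_cancel_left')
  ultimately have "norm (b - 1) \<le> 1/3"
    using lyb by simp
  then have c: "norm (a - 1) \<le> 1/10 + 1/3"
    using ab norm_triangle_ineq[of "a - b" "b - 1"] by simp
  have "y = (a - 1) - (a - 1) * y" using a by (simp add: algebra_simps)
  then have "norm y \<le> norm (a - 1) + norm ((a - 1) * y)"
    by (metis norm_triangle_ineq4)
  also have "norm ((a - 1) * y) \<le> norm (a - 1)"
    using norm_mult_ineq[of "a - 1" y] y by simp
  finally show False using c y by simp
qed

lemma power_two_power_Suc: "x ^ 2 ^ Suc n = x ^ 2 ^ n * x ^ 2 ^ n" for x :: "'a::monoid_mult"
  by (simp add: mult_2 power_add)

text \<open>
  Rickart's proof that the spectrum reaches the spectral radius, arranged around repeated squaring. If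
  \<open>1 - x * x\<close> were invertible, the resolvent of \<open>x\<close> would be continuous on the closed unit disc, hence
  uniformly so, and \<open>x\<close> would satisfy \<open>resolvent_close (1/10) l x\<close> for some \<open>l < 1\<close>. Squaring \<open>n\<close> times turns
  \<open>l\<close> into \<open>l ^ 2 ^ n\<close>, which tends to \<open>0\<close>, while the C*-identity keeps the norm of \<open>x ^ 2 ^ n\<close> equal to one.
\<close>

lemma not_unit_one_minus_square:
  fixes x :: "'a::unital_comm_real_cstar_algebra"
  assumes x: "star x = x" "norm x = 1"
  shows "\<not> unit_elt (1 - x * x)"
proof
  assume "unit_elt (1 - x * x)"
  moreover have "1 - x * x = (1 - x) * (1 + x)" by (simp add: algebra_simps)
  ultimately have pm: "unit_elt (1 - x)" "unit_elt (1 + x)" by (simp_all add: unit_elt_mult)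
  \<comment> \<open>For \<open>z\<close> other than 1 and -1 the denominator has no real zero in the relevant interval; the two
    exceptional points are where the assumed invertibility of \<open>1 - x * x\<close> enters.\<close>
  have unit: "unit_elt (peval (resolvent_den z) x)" if z: "cmod z \<le> 1" for z
  proof -
    consider "z = 1" | "z = -1" | "z \<noteq> 1" "z \<noteq> -1" by blast
    then show ?thesis
    proof cases
      case 1
      then have "peval (resolvent_den z) x = (1 - x) * (1 - x)"
        by (simp add: resolvent_den_def algebra_simps scaleR_2)
      then show ?thesis using pm by (simp add: unit_elt_mult)
    next
      case 2
      then have "peval (resolvent_den z) x = (1 + x) * (1 + x)"
        by (simp add: resolvent_den_def algebra_simps scaleR_2)
      then show ?thesis using pm by (simp add: unit_elt_mult)
    next
      case 3
      show ?thesis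
      proof (rule unit_elt_peval)
        fix t assume t: "\<bar>t\<bar> \<le> norm x"
        show "poly (resolvent_den z) t \<noteq> 0"
        proof
          assume "poly (resolvent_den z) t = 0"
          then have "(1 - Re z * t)\<^sup>2 + (Im z * t)\<^sup>2 = 0"
            using cmod_power2[of z] by (simp add: resolvent_den_def power2_eq_square algebra_simps)
          then have *: "Re z * t = 1" "Im z * t = 0"
            by (simp_all add: sum_power2_eq_zero_iff)
          then have "Im z = 0" by auto
          then have "\<bar>Re z\<bar> \<noteq> 1" using 3 by (auto simp: complex_eq_iff abs_if split: if_splits)
          moreover have "\<bar>Re z\<bar> \<le> 1" using z abs_Re_le_cmod order_trans by blast
          ultimately have "\<bar>Re z\<bar> * \<bar>t\<bar> < 1"
            using t x by (smt (verit) mult_left_le mult_nonneg_nonneg)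
          then show False using * by (metis abs_mult abs_one less_irrefl)
        qed
      qed (rule x)
    qed
  qed
  have "continuous_on (cball 0 1) (re_resolvent x)"
    unfolding re_resolvent_def
  proof (intro continuous_on_mult continuous_on_inv_elt)
    show "continuous_on (cball 0 1) (\<lambda>z. peval (resolvent_num z) x)"
      unfolding resolvent_num_def by (simp, intro continuous_intros)
    show "continuous_on (cball 0 1) (\<lambda>z. peval (resolvent_den z) x)"
      unfolding resolvent_den_def by (simp, intro continuous_intros)
  qed (use unit in auto)
  then have "uniformly_continuous_on (cball 0 1) (re_resolvent x)"
    by (rule compact_uniformly_continuous) simp
  then obtain d where d: "d > 0" and
    uc: "\<And>z w. z \<in> cball 0 1 \<Longrightarrow> w \<in> cball 0 1 \<Longrightarrow> dist w z < d \<Longrightarrow> dist (re_resolvent x w) (re_resolvent x z) < 1/10"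
    unfolding uniformly_continuous_on_def by (metis zero_less_divide_1_iff zero_less_numeral)
  define l where "l = max 0 (1 - d / 2)"
  have l: "0 \<le> l" "l < 1" "1 - l < d" using d by (auto simp: l_def)
  have close: "resolvent_close (1/10) l x"
    unfolding resolvent_close_def
  proof (intro conjI allI impI unit)
    fix z assume z: "cmod z = 1"
    have "z - l *\<^sub>R z = (1 - l) *\<^sub>R z" by (simp add: algebra_simps)
    then have "dist z (l *\<^sub>R z) < d" using l z by (simp add: dist_norm)
    then show "norm (re_resolvent x z - re_resolvent x (l *\<^sub>R z)) \<le> 1/10"
      using uc[of "l *\<^sub>R z" z] l z by (simp add: dist_norm)
  qed
  have pow: "resolvent_close (1/10) (l ^ 2 ^ n) (x ^ 2 ^ n) \<and> norm (x ^ 2 ^ n) = 1 \<and> star (x ^ 2 ^ n) = x ^ 2 ^ n" for n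
  proof (induction n)
    case 0
    then show ?case using close x by simp
  next
    case (Suc n)
    then show ?case
      unfolding power_two_power_Suc
      using resolvent_close_square[of "1/10" "l ^ 2 ^ n" "x ^ 2 ^ n"] l
      by (simp add: norm_square_selfadjoint star_mult power_le_one)
  qed
  have "(\<lambda>n. l ^ n) \<longlonglongrightarrow> 0" using l by (intro LIMSEQ_realpow_zero) auto
  then have "\<forall>\<^sub>F n in sequentially. l ^ n < 1/4"
    by (rule order_tendstoD) simp
  then obtain N where "\<And>n. n \<ge> N \<Longrightarrow> l ^ n < 1/4"
    unfolding eventually_sequentially by blast
  then have "l ^ 2 ^ N < 1/4" using less_exp[of N] by (simp add: less_imp_le)
  then show False
    using not_resolvent_close[of "x ^ 2 ^ N" "l ^ 2 ^ N"] pow[of N] l by simp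
qed

text \<open>
  Otherwise divide by the norm: \<open>q = p / norm (p x)\<close> has norm one at \<open>x\<close>, yet \<open>1 - q\<^sup>2\<close> has no zero in the
  interval and is therefore invertible at \<open>x\<close>.
\<close>

lemma norm_peval_le:
  fixes x :: "'a::unital_comm_real_cstar_algebra"
  assumes x: "star x = x" and M: "\<And>t. \<bar>t\<bar> \<le> norm x \<Longrightarrow> \<bar>poly p t\<bar> \<le> M"
  shows "norm (peval p x) \<le> M"
proof (rule ccontr)
  define r where "r = norm (peval p x)"
  assume "\<not> norm (peval p x) \<le> M"
  then have rM: "M < r" by (simp add: r_def)
  have "0 \<le> M" using M[of 0] by auto
  then have r: "r > 0" using rM by simp
  define q where "q = smult (1 / r) p"
  have q: "peval q x = (1 / r) *\<^sub>R peval p x" by (simp add: q_def peval_smult)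
  have "star (peval q x) = peval q x" "norm (peval q x) = 1"
    using r by (simp_all add: star_peval x) (simp add: q r_def)
  then have "\<not> unit_elt (1 - peval q x * peval q x)" by (rule not_unit_one_minus_square)
  moreover have "unit_elt (peval (1 - q * q) x)"
  proof (rule unit_elt_peval[OF x])
    fix t assume "\<bar>t\<bar> \<le> norm x"
    then have "\<bar>poly q t\<bar> < 1" using M[of t] rM r by (simp add: q_def)
    then have "(poly q t)\<^sup>2 < 1" by (simp add: abs_square_less_1)
    then show "poly (1 - q * q) t \<noteq> 0" by (simp add: power2_eq_square)
  qed
  ultimately show False by (simp add: peval_diff peval_mult)
qed

section \<open>Continuous functional calculus\<close>

lemma poly_approx:
  assumes "continuous_on {-r..r::real} f"
  shows "\<exists>p. uniform_limit {-r..r} (\<lambda>n. poly (p n)) f sequentially"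
proof -
  have "\<exists>q. \<forall>t\<in>{-r..r}. \<bar>f t - poly q t\<bar> < inverse (Suc n)" for n
  proof -
    obtain g where g: "real_polynomial_function g" "\<And>t. t \<in> {-r..r} \<Longrightarrow> \<bar>f t - g t\<bar> < inverse (Suc n)"
      using Stone_Weierstrass_real_polynomial_function[OF compact_Icc assms, of "inverse (Suc n)"] by auto
    obtain a m where "g = (\<lambda>t. \<Sum>i\<le>m. a i * t ^ i)"
      using real_polynomial_function_imp_sum[OF g(1)] by blast
    then have "poly (\<Sum>i\<le>m. monom (a i) i) t = g t" for t
      by (simp add: poly_sum poly_monom)
    then show ?thesis using g(2) by metis
  qed
  then obtain p where p: "\<And>n t. t \<in> {-r..r} \<Longrightarrow> \<bar>f t - poly (p n) t\<bar> < inverse (Suc n)"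
    by metis
  have "uniform_limit {-r..r} (\<lambda>n. poly (p n)) f sequentially"
  proof (rule uniform_limitI)
    fix e :: real assume "e > 0"
    then have "\<forall>\<^sub>F n in sequentially. inverse (real (Suc n)) < e"
      using order_tendstoD(2)[OF LIMSEQ_inverse_real_of_nat] by auto
    then show "\<forall>\<^sub>F n in sequentially. \<forall>t\<in>{-r..r}. dist (poly (p n) t) (f t) < e"
    proof eventually_elim
      case (elim n)
      show ?case
      proof
        fix t assume "t \<in> {-r..r}"
        from p[OF this, of n] elim show "dist (poly (p n) t) (f t) < e"
          unfolding dist_real_def by linarith
      qed
    qed
  qed
  then show ?thesis by blast
qed

text \<open>
  The common limit of \<open>p\<^sub>n x\<close> over all polynomial sequences \<open>p\<^sub>n\<close> approximating \<open>f\<close> uniformly on the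
  interval \<open>[- norm x, norm x]\<close>, which contains the spectrum of a self-adjoint \<open>x\<close>.
\<close>

definition cfc :: "(real \<Rightarrow> real) \<Rightarrow> 'a \<Rightarrow> 'a::unital_comm_real_cstar_algebra" where
  "cfc f x = (SOME y. \<forall>p. uniform_limit {-norm x..norm x} (\<lambda>n. poly (p n)) f sequentially \<longrightarrow>
     (\<lambda>n. peval (p n) x) \<longlonglongrightarrow> y)"

context
  fixes x :: "'a::unital_comm_real_cstar_algebra"
  assumes sa: "star x = x"
begin

lemma cfc_tendsto:
  assumes f: "continuous_on {-norm x..norm x} f"
    and p: "uniform_limit {-norm x..norm x} (\<lambda>n. poly (p n)) f sequentially"
  shows "(\<lambda>n. peval (p n) x) \<longlonglongrightarrow> cfc f x"
proof -
  let ?I = "{-norm x..norm x}"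
  have close: "norm (peval q x - peval q' x) \<le> e + e'"
    if "\<forall>t\<in>?I. dist (poly q t) (f t) < e" "\<forall>t\<in>?I. dist (poly q' t) (f t) < e'" for q q' e e'
  proof -
    have "norm (peval (q - q') x) \<le> e + e'"
    proof (rule norm_peval_le[OF sa])
      fix t assume "\<bar>t\<bar> \<le> norm x"
      then have "t \<in> ?I" by auto
      then show "\<bar>poly (q - q') t\<bar> \<le> e + e'"
        using that[rule_format, of t] unfolding dist_real_def poly_diff by linarith
    qed
    then show ?thesis by (simp add: peval_diff)
  qed
  obtain q where q: "uniform_limit ?I (\<lambda>n. poly (q n)) f sequentially"
    using poly_approx[OF f] by blast
  have ul: "\<exists>N. \<forall>n\<ge>N. \<forall>t\<in>?I. dist (poly (p n) t) (f t) < e"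
    if "uniform_limit ?I (\<lambda>n. poly (p n)) f sequentially" "e > 0" for p e
    using uniform_limitD[OF that] by (simp add: eventually_sequentially)
  have "Cauchy (\<lambda>n. peval (q n) x)"
  proof (rule CauchyI)
    fix e :: real assume "e > 0"
    then have "e / 3 > 0" by simp
    then obtain N where N: "\<And>n. n \<ge> N \<Longrightarrow> \<forall>t\<in>?I. dist (poly (q n) t) (f t) < e/3"
      using ul[OF q, of "e / 3"] by blast
    show "\<exists>M. \<forall>m\<ge>M. \<forall>n\<ge>M. norm (peval (q m) x - peval (q n) x) < e"
    proof (intro exI allI impI)
      fix m n assume "m \<ge> N" "n \<ge> N"
      then show "norm (peval (q m) x - peval (q n) x) < e"
        using close[OF N N, of m n] \<open>e > 0\<close> by simp
    qed
  qed
  then obtain y where y: "(\<lambda>n. peval (q n) x) \<longlonglongrightarrow> y"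
    using Cauchy_convergent convergent_def by blast
  have "(\<lambda>n. peval (p n) x) \<longlonglongrightarrow> y"
    if p: "uniform_limit ?I (\<lambda>n. poly (p n)) f sequentially" for p
  proof -
    have "(\<lambda>n. peval (p n) x - peval (q n) x) \<longlonglongrightarrow> 0"
    proof (rule LIMSEQ_I)
      fix e :: real assume "e > 0"
      then have e3: "e / 3 > 0" by simp
      obtain M where M: "\<And>n. n \<ge> M \<Longrightarrow> \<forall>t\<in>?I. dist (poly (p n) t) (f t) < e/3"
        using ul[OF p e3] by blast
      obtain N where N: "\<And>n. n \<ge> N \<Longrightarrow> \<forall>t\<in>?I. dist (poly (q n) t) (f t) < e/3"
        using ul[OF q e3] by blast
      have "norm (peval (p n) x - peval (q n) x - 0) < e" if "n \<ge> max M N" for n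
        using close[OF M N, of n n] that \<open>e > 0\<close> by simp
      then show "\<exists>no. \<forall>n\<ge>no. norm (peval (p n) x - peval (q n) x - 0) < e" by blast
    qed
    from tendsto_add[OF this y] show ?thesis by simp
  qed
  then have "\<exists>y. \<forall>p. uniform_limit ?I (\<lambda>n. poly (p n)) f sequentially \<longrightarrow> (\<lambda>n. peval (p n) x) \<longlonglongrightarrow> y"
    by blast
  from someI_ex[OF this] show ?thesis
    using p unfolding cfc_def by blast
qed

lemma cfc_poly: "cfc (poly q) x = peval q x"
proof -
  have "(\<lambda>n. peval q x) \<longlonglongrightarrow> cfc (poly q) x"
    by (rule cfc_tendsto[of _ "\<lambda>_. q"]) (auto intro!: continuous_intros uniform_limitI)
  then show ?thesis
    by (simp add: LIMSEQ_const_iff)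
qed

lemma cfc_id: "cfc (\<lambda>t. t) x = x"
proof -
  have "poly [:0, 1:] = (\<lambda>t::real. t)" by (simp add: fun_eq_iff)
  then show ?thesis using cfc_poly[of "[:0, 1:]"] by simp
qed

lemma cfc_const: "cfc (\<lambda>t. c) x = c *\<^sub>R 1"
proof -
  have "poly [:c:] = (\<lambda>t::real. c)" by (simp add: fun_eq_iff)
  then show ?thesis using cfc_poly[of "[:c:]"] by simp
qed

lemma cfc_add:
  assumes "continuous_on {-norm x..norm x} f" "continuous_on {-norm x..norm x} g"
  shows "cfc (\<lambda>t. f t + g t) x = cfc f x + cfc g x"
proof -
  obtain p q where p: "uniform_limit {-norm x..norm x} (\<lambda>n. poly (p n)) f sequentially"
    and q: "uniform_limit {-norm x..norm x} (\<lambda>n. poly (q n)) g sequentially"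
    using poly_approx[OF assms(1)] poly_approx[OF assms(2)] by blast
  have "uniform_limit {-norm x..norm x} (\<lambda>n. poly (p n + q n)) (\<lambda>t. f t + g t) sequentially"
    using uniform_limit_add[OF p q] by (simp add: poly_add[abs_def])
  then have "(\<lambda>n. peval (p n + q n) x) \<longlonglongrightarrow> cfc (\<lambda>t. f t + g t) x"
    by (intro cfc_tendsto continuous_intros assms)
  moreover have "(\<lambda>n. peval (p n + q n) x) \<longlonglongrightarrow> cfc f x + cfc g x"
    unfolding peval_add by (intro tendsto_add cfc_tendsto assms p q)
  ultimately show ?thesis by (rule LIMSEQ_unique)
qed

lemma cfc_mult:
  assumes "continuous_on {-norm x..norm x} f" "continuous_on {-norm x..norm x} g"
  shows "cfc (\<lambda>t. f t * g t) x = cfc f x * cfc g x"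
proof -
  obtain p q where p: "uniform_limit {-norm x..norm x} (\<lambda>n. poly (p n)) f sequentially"
    and q: "uniform_limit {-norm x..norm x} (\<lambda>n. poly (q n)) g sequentially"
    using poly_approx[OF assms(1)] poly_approx[OF assms(2)] by blast
  have "bounded (f ` {-norm x..norm x})" "bounded (g ` {-norm x..norm x})"
    by (auto intro!: compact_imp_bounded compact_continuous_image assms)
  then have "uniform_limit {-norm x..norm x} (\<lambda>n. poly (p n * q n)) (\<lambda>t. f t * g t) sequentially"
    using uniform_lim_mult[OF p q] by (simp add: poly_mult[abs_def])
  then have "(\<lambda>n. peval (p n * q n) x) \<longlonglongrightarrow> cfc (\<lambda>t. f t * g t) x"
    by (intro cfc_tendsto continuous_intros assms)
  moreover have "(\<lambda>n. peval (p n * q n) x) \<longlonglongrightarrow> cfc f x * cfc g x"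
    unfolding peval_mult by (intro tendsto_mult cfc_tendsto assms p q)
  ultimately show ?thesis by (rule LIMSEQ_unique)
qed

lemma cfc_cmult:
  assumes "continuous_on {-norm x..norm x} f"
  shows "cfc (\<lambda>t. c * f t) x = c *\<^sub>R cfc f x"
  using cfc_mult[of "\<lambda>_. c" f] assms by (simp add: cfc_const)

lemma cfc_diff:
  assumes "continuous_on {-norm x..norm x} f" "continuous_on {-norm x..norm x} g"
  shows "cfc (\<lambda>t. f t - g t) x = cfc f x - cfc g x"
  using cfc_add[of f "\<lambda>t. -1 * g t"] cfc_cmult[of g "-1"] assms
  by (simp add: continuous_on_minus)

lemma cfc_sum:
  assumes "\<And>i. i \<in> I \<Longrightarrow> continuous_on {-norm x..norm x} (f i)"
  shows "cfc (\<lambda>t. \<Sum>i\<in>I. f i t) x = (\<Sum>i\<in>I. cfc (f i) x)"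
  using assms
proof (induction I rule: infinite_finite_induct)
  case (insert i I)
  then show ?case
    by (simp add: cfc_add continuous_on_sum)
qed (simp_all add: cfc_const)

lemma cfc_cong:
  assumes "\<And>t. \<bar>t\<bar> \<le> norm x \<Longrightarrow> f t = g t"
  shows "cfc f x = cfc g x"
proof -
  have "uniform_limit {-norm x..norm x} (\<lambda>n. poly (p n)) f sequentially =
        uniform_limit {-norm x..norm x} (\<lambda>n. poly (p n)) g sequentially" for p
    by (intro uniform_limit_cong' refl) (auto intro: assms)
  then show ?thesis by (simp add: cfc_def)
qed

lemma norm_cfc_le:
  assumes f: "continuous_on {-norm x..norm x} f" and M: "\<And>t. \<bar>t\<bar> \<le> norm x \<Longrightarrow> \<bar>f t\<bar> \<le> M"
  shows "norm (cfc f x) \<le> M"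
proof (rule field_le_epsilon)
  fix e :: real assume e: "e > 0"
  obtain p where p: "uniform_limit {-norm x..norm x} (\<lambda>n. poly (p n)) f sequentially"
    using poly_approx[OF f] by blast
  have "\<forall>\<^sub>F n in sequentially. \<forall>t\<in>{-norm x..norm x}. dist (poly (p n) t) (f t) < e"
    using uniform_limitD[OF p e] .
  then have "\<forall>\<^sub>F n in sequentially. norm (peval (p n) x) \<le> M + e"
  proof eventually_elim
    case (elim n)
    show ?case
    proof (rule norm_peval_le[OF sa])
      fix t assume "\<bar>t\<bar> \<le> norm x"
      then have "t \<in> {-norm x..norm x}" "\<bar>f t\<bar> \<le> M" using M by auto
      then show "\<bar>poly (p n) t\<bar> \<le> M + e"
        using elim[rule_format, of t] unfolding dist_real_def by linarith
    qed
  qed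
  then show "norm (cfc f x) \<le> M + e"
    by (intro tendsto_upperbound[OF tendsto_norm[OF cfc_tendsto[OF f p]]]) auto
qed

lemma star_cfc:
  assumes f: "continuous_on {-norm x..norm x} f"
  shows "star (cfc f x) = cfc f x"
proof -
  obtain p where p: "uniform_limit {-norm x..norm x} (\<lambda>n. poly (p n)) f sequentially"
    using poly_approx[OF f] by blast
  have lim: "(\<lambda>n. peval (p n) x) \<longlonglongrightarrow> cfc f x" by (rule cfc_tendsto[OF f p])
  have "bounded_linear (star :: 'a \<Rightarrow> 'a)"
    by (rule bounded_linear_intro[of _ 1]) (simp_all add: star_add star_scaleR norm_star)
  from bounded_linear.tendsto[OF this lim]
  have "(\<lambda>n. peval (p n) x) \<longlonglongrightarrow> star (cfc f x)" by (simp add: star_peval sa)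
  then show ?thesis using lim LIMSEQ_unique by blast
qed

end

section \<open>The closed graph theorem\<close>

text \<open>
  By Baire's theorem the closure of some set \<open>{x. norm (T x) \<le> n}\<close> contains a ball. These sets are convex and
  symmetric, so every \<open>x\<close> can be approximated up to \<open>norm x / 2\<close> by some \<open>F x\<close> with
  \<open>norm (T (F x)) \<le> K * norm x\<close>. Iterating on the remainder writes \<open>x\<close> as a series whose image under \<open>T\<close> converges
  absolutely, and the closed graph identifies the sum of the images with \<open>T x\<close>.
\<close>

lemma closed_graph_imp_bounded:
  fixes T :: "'a::banach \<Rightarrow> 'b::banach"
  assumes lin: "linear T"
    and graph: "\<And>X x y. X \<longlonglongrightarrow> x \<Longrightarrow> (\<lambda>n. T (X n)) \<longlonglongrightarrow> y \<Longrightarrow> T x = y"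
  shows "bounded_linear T"
proof -
  interpret T: linear T by (rule lin)
  define C where "C n = closure {x. norm (T x) \<le> real n}" for n :: nat
  have "\<exists>n x r. r > 0 \<and> ball x r \<subseteq> C n"
  proof (rule ccontr)
    assume no: "\<not> ?thesis"
    have empty: "interior (C n) = {}" for n
      using no by (auto simp: mem_interior)
    have int: "Met_TC.mtopology interior_of \<Union>(range C) = {}"
    proof (rule Met_TC.metric_Baire_category_alt)
      show "closedin Met_TC.mtopology S \<and> Met_TC.mtopology interior_of S = {}" if "S \<in> range C" for S
        using that empty by (auto simp: C_def)
    qed (auto simp: complete_UNIV)
    have "x \<in> \<Union>(range C)" for x
    proof -
      obtain n where "norm (T x) \<le> real n" using real_arch_simple[of "norm (T x)"] by auto
      then have "x \<in> C n" using closure_subset[of "{x. norm (T x) \<le> real n}"] by (auto simp: C_def)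
      then show ?thesis by blast
    qed
    then have "\<Union>(range C) = UNIV" by blast
    then show False using int by simp
  qed
  then obtain n x0 r where r: "r > 0" and ball: "ball x0 r \<subseteq> C n" by blast
  have approx0: "\<exists>y. norm (x - y) < e \<and> norm (T y) \<le> n" if x: "norm x < r" and e: "e > 0" for x e
  proof -
    \<comment> \<open>Half the difference of these two points is \<open>x\<close>: this moves the ball to the origin.\<close>
    have "x0 + x \<in> C n" "x0 - x \<in> C n"
      using x ball by (auto simp: subset_iff dist_norm)
    then obtain u v where u: "norm (T u) \<le> n" "dist u (x0 + x) < e"
      and v: "norm (T v) \<le> n" "dist v (x0 - x) < e"
      using e unfolding C_def closure_approachable by blast
    have "x - (1/2) *\<^sub>R (u - v) = (1/2) *\<^sub>R ((x0 + x - u) - (x0 - x - v))"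
      by (simp add: algebra_simps flip: scaleR_left_distrib)
    then have "norm (x - (1/2) *\<^sub>R (u - v)) < e"
      using norm_triangle_ineq4[of "x0 + x - u" "x0 - x - v"] u v
      by (simp add: dist_norm norm_minus_commute)
    moreover have "norm (T ((1/2) *\<^sub>R (u - v))) \<le> n"
      using norm_triangle_ineq4[of "T u" "T v"] u v by (simp add: T.scaleR T.diff)
    ultimately show ?thesis by blast
  qed
  define K where "K = 2 * real n / r"
  have K: "K \<ge> 0" using r by (simp add: K_def)
  have "\<exists>y. norm (x - y) \<le> norm x / 2 \<and> norm (T y) \<le> K * norm x" for x
  proof (cases "x = 0")
    case True
    then show ?thesis by (intro exI[of _ 0]) (simp add: T.zero)
  next
    case False
    define c where "c = r / (2 * norm x)"
    have c: "c > 0" using r False by (simp add: c_def)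
    have "norm (c *\<^sub>R x) < r" using r False by (simp add: c_def)
    then obtain y where y: "norm (c *\<^sub>R x - y) < r / 4" "norm (T y) \<le> n"
      using approx0[of "c *\<^sub>R x" "r / 4"] r by auto
    have "x - (1 / c) *\<^sub>R y = (1 / c) *\<^sub>R (c *\<^sub>R x - y)"
      using c by (simp add: scaleR_diff_right)
    then have "norm (x - (1 / c) *\<^sub>R y) \<le> (1 / c) * (r / 4)"
      using y(1) c mult_left_mono[of "norm (c *\<^sub>R x - y)" "r / 4" "1 / c"] by simp
    also have "\<dots> = norm x / 2" using r False by (simp add: c_def)
    finally have "norm (x - (1 / c) *\<^sub>R y) \<le> norm x / 2" .
    moreover have "norm (T ((1 / c) *\<^sub>R y)) \<le> (1 / c) * n"
      using y c by (simp add: T.scaleR divide_right_mono)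
    then have "norm (T ((1 / c) *\<^sub>R y)) \<le> K * norm x"
      using r False by (simp add: c_def K_def mult_ac)
    ultimately show ?thesis by blast
  qed
  then obtain F where F: "\<And>x. norm (x - F x) \<le> norm x / 2" "\<And>x. norm (T (F x)) \<le> K * norm x"
    by metis
  have "norm (T x) \<le> norm x * (2 * K)" for x
  proof -
    define X where "X k = ((\<lambda>x. x - F x) ^^ k) x" for k
    have X0: "X 0 = x" and XS: "X (Suc k) = X k - F (X k)" for k by (simp_all add: X_def)
    have Xn: "norm (X k) \<le> norm x * (1/2) ^ k" for k
    proof (induction k)
      case (Suc k)
      then show ?case using F(1)[of "X k"] by (simp add: XS)
    qed (simp add: X0)
    have sumF: "(\<Sum>j<k. F (X j)) = x - X k" for k
      by (induction k) (simp_all add: X0 XS)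
    have half: "(\<lambda>k. norm x * (1/2) ^ k) \<longlonglongrightarrow> norm x * 0"
      by (intro tendsto_intros LIMSEQ_realpow_zero) auto
    have "X \<longlonglongrightarrow> 0"
      by (rule Lim_null_comparison[of _ "\<lambda>k. norm x * (1/2) ^ k"]) (use Xn half in auto)
    then have lim: "(\<lambda>k. \<Sum>j<k. F (X j)) \<longlonglongrightarrow> x"
      unfolding sumF using tendsto_diff[OF tendsto_const[of x]] by fastforce
    have TF: "norm (T (F (X k))) \<le> K * norm x * (1/2) ^ k" for k
      using order_trans[OF F(2)[of "X k"] mult_left_mono[OF Xn[of k] K]] by (simp add: mult.assoc)
    have geo: "(\<lambda>k. K * norm x * (1/2) ^ k) sums (K * norm x * 2)"
      using sums_mult[OF geometric_sums[of "1/2::real"], of "K * norm x"] by simp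
    have sm: "summable (\<lambda>k. norm (T (F (X k))))"
      by (rule summable_comparison_test'[OF sums_summable[OF geo]]) (use TF in simp)
    have "(\<lambda>k. T (F (X k))) sums (\<Sum>k. T (F (X k)))"
      by (rule summable_sums[OF summable_norm_cancel[OF sm]])
    then have "(\<lambda>k. T (\<Sum>j<k. F (X j))) \<longlonglongrightarrow> (\<Sum>k. T (F (X k)))"
      by (simp add: sums_def T.sum)
    then have "T x = (\<Sum>k. T (F (X k)))" by (rule graph[OF lim])
    also have "norm \<dots> \<le> (\<Sum>k. norm (T (F (X k))))" by (rule summable_norm[OF sm])
    also have "\<dots> \<le> (\<Sum>k. K * norm x * (1/2) ^ k)"
      by (rule suminf_le[OF TF sm sums_summable[OF geo]])
    also have "\<dots> = norm x * (2 * K)" by (simp add: sums_unique[OF geo, symmetric])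
    finally show ?thesis .
  qed
  then show ?thesis
    by (intro bounded_linear_intro[of T "2 * K"] T.add T.scaleR)
qed

section \<open>Multipliers that make a separating map bounded\<close>

text \<open>
  A gliding hump: for \<open>s = (\<Sum>n. x n / 2 ^ n)\<close> the term \<open>x n / 2 ^ n\<close> is orthogonal to the rest of the
  series, so \<open>norm (T s)\<close> dominates \<open>norm (T (x n)) / 2 ^ n\<close> for every \<open>n\<close>. With \<open>norm (T (x n)) \<ge> 4 ^ n\<close>
  throughout, this would exceed every bound.
\<close>

lemma orthogonal_sequence_bounded:
  fixes T :: "'a::unital_comm_real_cstar_algebra \<Rightarrow> 'b::unital_comm_real_cstar_algebra"
  assumes lin: "linear T" and sep: "\<And>a b. a * b = 0 \<Longrightarrow> T a * T b = 0"
    and orth: "\<And>m n. m \<noteq> n \<Longrightarrow> x m * x n = 0" and x1: "\<And>n::nat. norm (x n) \<le> 1"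
  shows "\<exists>n. norm (T (x n)) < 4 ^ n"
proof (rule ccontr)
  interpret T: linear T by (rule lin)
  assume "\<not> ?thesis"
  then have big: "4 ^ n \<le> norm (T (x n))" for n by (simp add: not_less)
  define y where "y n = (1/2) ^ n *\<^sub>R x n" for n
  have "norm (y n) \<le> (1/2) ^ n" for n
    using x1[of n] by (simp add: y_def mult_left_le)
  then have "summable (\<lambda>n. norm (y n))"
    by (intro summable_comparison_test'[OF summable_geometric[of "1/2::real"]]) auto
  then have sm: "summable y" by (rule summable_norm_cancel)
  have orth_rest: "y n * (suminf y - y n) = 0" for n
  proof -
    have "y n * suminf y = (\<Sum>m. y n * y m)" by (rule suminf_mult[OF sm, symmetric])
    also have "\<dots> = (\<Sum>m\<in>{n}. y n * y m)"
      by (rule suminf_finite) (auto simp: y_def orth)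
    finally show ?thesis by (simp add: right_diff_distrib)
  qed
  have "2 ^ n \<le> norm (T (suminf y))" for n
  proof -
    have "(2::real) ^ n = (1/2) ^ n * 4 ^ n" by (simp flip: power_mult_distrib)
    also have "\<dots> \<le> (1/2) ^ n * norm (T (x n))" by (intro mult_left_mono big) auto
    also have "\<dots> = norm (T (y n))" by (simp add: y_def T.scaleR)
    also have "\<dots> \<le> norm (T (y n) + T (suminf y - y n))"
      by (rule norm_orthogonal_summand_le[OF sep[OF orth_rest]])
    also have "\<dots> = norm (T (suminf y))" by (simp add: T.diff)
    finally show ?thesis .
  qed
  then show False
    using real_arch_pow[of 2 "norm (T (suminf y))"] by (auto simp: not_le[symmetric])
qed

definition mult_bounded :: "('a::real_normed_algebra \<Rightarrow> 'b::real_normed_vector) \<Rightarrow> 'a \<Rightarrow> bool" where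
  "mult_bounded T s \<longleftrightarrow> (\<exists>K. \<forall>a. norm (T (s * a)) \<le> K * norm a)"

lemma mult_bounded_mult:
  assumes "mult_bounded T s"
  shows "mult_bounded T (s * b)"
proof -
  obtain K where K: "\<And>a. norm (T (s * a)) \<le> K * norm a"
    using assms unfolding mult_bounded_def by blast
  have "norm (T (s * b * a)) \<le> (\<bar>K\<bar> * norm b) * norm a" for a
  proof -
    have "norm (T (s * b * a)) \<le> K * norm (b * a)" using K[of "b * a"] by (simp add: mult.assoc)
    also have "\<dots> \<le> \<bar>K\<bar> * (norm b * norm a)" by (intro mult_mono norm_mult_ineq) auto
    finally show ?thesis by (simp add: mult.assoc)
  qed
  then show ?thesis unfolding mult_bounded_def by blast
qed

lemma mult_unbounded_witness:
  fixes T :: "'a::real_normed_algebra \<Rightarrow> 'b::real_normed_vector"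
  assumes lin: "linear T" and "\<not> mult_bounded T s"
  shows "\<exists>a. norm (s * a) \<le> 1 \<and> M \<le> norm (T (s * a))"
proof -
  interpret T: linear T by (rule lin)
  define c where "c = norm s + 1"
  have c: "c > 0" by (simp add: c_def add_nonneg_pos)
  obtain a where a: "norm (T (s * a)) > (\<bar>M\<bar> * c) * norm a"
    using assms unfolding mult_bounded_def by (meson not_le)
  then have "a \<noteq> 0" by (auto simp: T.zero)
  define b where "b = (1 / (c * norm a)) *\<^sub>R a"
  have "norm (s * a) \<le> c * norm a"
    using norm_mult_ineq[of s a] mult_right_mono[of "norm s" c "norm a"] by (simp add: c_def)
  then have "norm (s * b) \<le> 1"
    using \<open>a \<noteq> 0\<close> c by (simp add: b_def divide_le_eq)
  moreover have "\<bar>M\<bar> \<le> norm (T (s * b))"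
    using a \<open>a \<noteq> 0\<close> c by (simp add: b_def T.scaleR le_divide_eq mult_ac)
  ultimately show ?thesis by (intro exI[of _ b]) auto
qed

text \<open>
  For each real \<open>c\<close> the positive and negative parts \<open>P c\<close> and \<open>N c\<close> of \<open>h - c\<close> are orthogonal, so \<open>g\<close> annihilates
  one of them. The two closed sets of such \<open>c\<close> are nonempty and cover the real line; by connectedness
  they meet, and at a common point \<open>g * (h - c) = 0\<close>.
\<close>

lemma no_orthogonal_multiples_selfadjoint:
  fixes g h :: "'a::unital_comm_real_cstar_algebra"
  assumes g: "\<And>a b. (g * a) * (g * b) = 0 \<Longrightarrow> g * a = 0 \<or> g * b = 0" and h: "star h = h"
  shows "\<exists>c. g * h = c *\<^sub>R g"
proof -
  define P where "P c = cfc (\<lambda>t. max 0 (t - c)) h" for c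
  define N where "N c = cfc (\<lambda>t. max 0 (c - t)) h" for c
  have lipP: "dist (P c) (P d) \<le> 1 * dist c d" for c d
    unfolding P_def dist_norm
    by (subst cfc_diff[OF h, symmetric]) (auto intro!: continuous_intros norm_cfc_le[OF h])
  have lipN: "dist (N c) (N d) \<le> 1 * dist c d" for c d
    unfolding N_def dist_norm
    by (subst cfc_diff[OF h, symmetric]) (auto intro!: continuous_intros norm_cfc_le[OF h])
  have "1-lipschitz_on UNIV P" "1-lipschitz_on UNIV N"
    using lipP lipN by (auto intro!: lipschitz_onI)
  then have cont: "continuous_on UNIV P" "continuous_on UNIV N"
    by (auto intro: lipschitz_on_continuous_on)
  have closed: "closed {c. g * P c = 0}" "closed {c. g * N c = 0}"
    by (intro closed_Collect_eq continuous_intros cont)+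
  have PN: "P c * N c = 0" for c
  proof -
    have "(\<lambda>t. max 0 (t - c) * max 0 (c - t)) = (\<lambda>_. 0)"
      by (auto simp: max_def fun_eq_iff)
    then have "cfc (\<lambda>t. max 0 (t - c) * max 0 (c - t)) h = 0"
      by (simp only:) (simp add: cfc_const[OF h])
    moreover have "cfc (\<lambda>t. max 0 (t - c) * max 0 (c - t)) h = P c * N c"
      unfolding P_def N_def by (intro cfc_mult[OF h] continuous_intros)
    ultimately show ?thesis by simp
  qed
  have diff: "P c - N c = h - c *\<^sub>R 1" for c
  proof -
    have "P c - N c = cfc (\<lambda>t. t - c) h"
      unfolding P_def N_def
      by (subst cfc_diff[OF h, symmetric]) (auto intro!: continuous_intros cfc_cong[OF h])
    also have "\<dots> = h - c *\<^sub>R 1"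
      by (subst cfc_diff[OF h]) (auto intro!: continuous_intros simp: cfc_id[OF h] cfc_const[OF h])
    finally show ?thesis .
  qed
  have "g * P c = 0 \<or> g * N c = 0" for c
  proof (rule g)
    have "g * P c * (g * N c) = g * g * (P c * N c)" by (simp add: ac_simps)
    then show "g * P c * (g * N c) = 0" by (simp add: PN)
  qed
  then have cover: "UNIV \<subseteq> {c. g * P c = 0} \<union> {c. g * N c = 0}" by blast
  have "P (norm h) = 0"
    using cfc_cong[OF h, of "\<lambda>t. max 0 (t - norm h)" "\<lambda>_. 0"] by (auto simp: P_def cfc_const[OF h])
  then have neP: "norm h \<in> {c. g * P c = 0}" by simp
  have "N (- norm h) = 0"
    using cfc_cong[OF h, of "\<lambda>t. max 0 (- norm h - t)" "\<lambda>_. 0"] by (auto simp: N_def cfc_const[OF h])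
  then have neN: "- norm h \<in> {c. g * N c = 0}" by simp
  have "{c. g * P c = 0} \<inter> {c. g * N c = 0} \<noteq> {}"
    using connected_closedD[OF connected_UNIV _ cover closed] neP neN by blast
  then obtain c where "g * P c = 0" "g * N c = 0" by blast
  then have "g * (h - c *\<^sub>R 1) = 0" by (simp add: right_diff_distrib flip: diff)
  then show ?thesis by (simp add: right_diff_distrib)
qed

text \<open>
  The products of \<open>g\<close> with self-adjoint elements lie on the line through \<open>g\<close>. If a skew element \<open>k\<close> has \<open>g * k \<noteq> 0\<close>, then for
  every skew \<open>l\<close> the products \<open>star k * k\<close> and \<open>star k * l\<close> are self-adjoint and act on \<open>g\<close> as scalars, which makes
  \<open>g * l\<close> a multiple of \<open>g * k\<close>. So the multiples of \<open>g\<close> lie in the span of two elements.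
\<close>

lemma no_orthogonal_multiples_mult_bounded:
  fixes T :: "'a::unital_comm_real_cstar_algebra \<Rightarrow> 'b::real_normed_vector"
  assumes lin: "linear T"
    and g: "\<And>a b. (g * a) * (g * b) = 0 \<Longrightarrow> g * a = 0 \<or> g * b = 0"
  shows "mult_bounded T g"
proof -
  interpret T: linear T by (rule lin)
  have "\<exists>u. \<forall>k. star k = - k \<longrightarrow> (\<exists>c. g * k = c *\<^sub>R u)"
  proof (cases "\<exists>k. star k = - k \<and> g * k \<noteq> 0")
    case True
    then obtain k where k: "star k = - k" "g * k \<noteq> 0" by blast
    have sa: "star (star k * l) = star k * l" if "star l = - l" for l
      using that k by (simp add: star_mult star_minus mult.commute)
    obtain c where c: "g * (star k * k) = c *\<^sub>R g"
      using no_orthogonal_multiples_selfadjoint[OF g sa[OF k(1)]] by blast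
    have "c \<noteq> 0"
    proof
      assume "c = 0"
      then have "star k * k * g = 0" using c by (simp add: mult.commute)
      then have "k * g = 0" by (rule star_mult_cancel)
      then show False using k by (simp add: mult.commute)
    qed
    have "\<exists>e. g * l = e *\<^sub>R (g * k)" if l: "star l = - l" for l
    proof -
      obtain d where d: "g * (star k * l) = d *\<^sub>R g"
        using no_orthogonal_multiples_selfadjoint[OF g sa[OF l]] by blast
      have "c *\<^sub>R (g * l) = g * (star k * k) * l" using c by simp
      also have "\<dots> = g * (star k * l) * k" by (simp add: ac_simps)
      also have "\<dots> = d *\<^sub>R (g * k)" using d by simp
      finally have "inverse c *\<^sub>R c *\<^sub>R (g * l) = inverse c *\<^sub>R d *\<^sub>R (g * k)" by simp
      then show ?thesis using \<open>c \<noteq> 0\<close> by auto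
    qed
    then show ?thesis by blast
  next
    case False
    then have "\<forall>k. star k = - k \<longrightarrow> g * k = 0 *\<^sub>R 0" by auto
    then show ?thesis by blast
  qed
  then obtain u where u: "\<And>k. star k = - k \<Longrightarrow> \<exists>c. g * k = c *\<^sub>R u" by blast
  \<comment> \<open>On a line every linear map is bounded; \<open>v\<close> will be \<open>g\<close> and \<open>u\<close>.\<close>
  have ineq: "\<exists>K. \<forall>a c. g * a = c *\<^sub>R v \<longrightarrow> norm (T (g * a)) \<le> K * norm a" for v
  proof (cases "v = 0")
    case True
    then show ?thesis by (intro exI[of _ 0]) (auto simp: T.zero)
  next
    case False
    have "norm (T (g * a)) \<le> (norm (T v) * norm g / norm v) * norm a" if "g * a = c *\<^sub>R v" for a c
    proof -
      have "\<bar>c\<bar> * norm v \<le> norm g * norm a"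
        using norm_mult_ineq[of g a] by (simp add: that)
      then have *: "norm (T v) * (\<bar>c\<bar> * norm v) \<le> norm (T v) * (norm g * norm a)"
        by (intro mult_left_mono) auto
      have **: "norm (T (g * a)) = \<bar>c\<bar> * norm (T v)" by (simp add: that T.scaleR)
      show ?thesis unfolding ** using * False by (simp add: field_simps)
    qed
    then show ?thesis by blast
  qed
  obtain K where K: "\<And>a c. g * a = c *\<^sub>R g \<Longrightarrow> norm (T (g * a)) \<le> K * norm a"
    using ineq by blast
  obtain L where L: "\<And>a c. g * a = c *\<^sub>R u \<Longrightarrow> norm (T (g * a)) \<le> L * norm a"
    using ineq by blast
  have "norm (T (g * a)) \<le> (\<bar>K\<bar> + \<bar>L\<bar>) * norm a" for a
  proof -
    define h where "h = (1/2) *\<^sub>R (a + star a)"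
    define k where "k = (1/2) *\<^sub>R (a - star a)"
    have h: "star h = h" and k: "star k = - k"
      by (simp_all add: h_def k_def star_scaleR star_add star_diff star_star add.commute
          flip: scaleR_minus_right)
    have a: "a = h + k" by (simp add: h_def k_def algebra_simps flip: scaleR_left_distrib)
    have nh: "norm h \<le> norm a" and nk: "norm k \<le> norm a"
      using norm_triangle_ineq[of a "star a"] norm_triangle_ineq4[of a "star a"]
      by (simp_all add: h_def k_def norm_star)
    have "norm (T (g * h)) \<le> K * norm h"
      using no_orthogonal_multiples_selfadjoint[OF g h] K by blast
    also have "\<dots> \<le> \<bar>K\<bar> * norm a" by (intro mult_mono nh) auto
    finally have 1: "norm (T (g * h)) \<le> \<bar>K\<bar> * norm a" .
    have "norm (T (g * k)) \<le> L * norm k" using u[OF k] L by blast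
    also have "\<dots> \<le> \<bar>L\<bar> * norm a" by (intro mult_mono nk) auto
    finally have 2: "norm (T (g * k)) \<le> \<bar>L\<bar> * norm a" .
    have "norm (T (g * a)) \<le> norm (T (g * h)) + norm (T (g * k))"
      unfolding a distrib_left T.add by (rule norm_triangle_ineq)
    with 1 2 show ?thesis by (simp add: distrib_right)
  qed
  then show ?thesis unfolding mult_bounded_def by blast
qed

text \<open>
  Suppose that everything in the ideal of bounded multipliers annihilates \<open>f\<close>. A multiple \<open>g\<close> of \<open>f\<close> in the
  ideal then satisfies \<open>g * g = 0\<close>, hence vanishes. So all nonzero multiples of \<open>f\<close> are unbounded
  multipliers, and each has two orthogonal nonzero multiples. Keeping one of them, \<open>h n\<close>, and
  splitting the other, \<open>G (Suc n)\<close>, at each stage yields an infinite orthogonal sequence of unbounded multipliers, against the gliding hump.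
\<close>

lemma mult_bounded_essential:
  fixes T :: "'a::unital_comm_real_cstar_algebra \<Rightarrow> 'b::unital_comm_real_cstar_algebra"
  assumes lin: "linear T" and sep: "\<And>a b. a * b = 0 \<Longrightarrow> T a * T b = 0" and f: "f \<noteq> 0"
  shows "\<exists>s. mult_bounded T s \<and> s * f \<noteq> 0"
proof (rule ccontr)
  assume "\<not> ?thesis"
  then have ann: "s * f = 0" if "mult_bounded T s" for s using that by blast
  have unbdd: "\<not> mult_bounded T g" if g: "f dvd g" "g \<noteq> 0" for g
  proof
    assume "mult_bounded T g"
    then have "g * f = 0" by (rule ann)
    moreover obtain a where "g = f * a" using g by (elim dvdE)
    ultimately have "g * g = 0" by (metis mult.assoc mult_zero_left)
    then show False using g square_zero_imp_zero by blast
  qed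
  have "\<exists>G. \<forall>n. (f dvd G n \<and> G n \<noteq> 0) \<and> (\<exists>h. h \<noteq> 0 \<and> G n dvd h \<and> h * G (Suc n) = 0 \<and> G n dvd G (Suc n))"
  proof (rule dependent_nat_choice)
    show "\<exists>g. f dvd g \<and> g \<noteq> 0" using f by (intro exI[of _ f]) auto
  next
    fix g and n :: nat assume g: "f dvd g \<and> g \<noteq> 0"
    then have "\<not> mult_bounded T g" using unbdd by blast
    then obtain a b where ab: "(g * a) * (g * b) = 0" "g * a \<noteq> 0" "g * b \<noteq> 0"
      using no_orthogonal_multiples_mult_bounded[OF lin, of g] by blast
    have "f dvd g * b" using g by (auto intro: dvd_mult2)
    then show "\<exists>g'. (f dvd g' \<and> g' \<noteq> 0) \<and> (\<exists>h. h \<noteq> 0 \<and> g dvd h \<and> h * g' = 0 \<and> g dvd g')"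
      using ab by (intro exI[of _ "g * b"] conjI exI[of _ "g * a"]) auto
  qed
  then obtain G where GG: "\<And>n. (f dvd G n \<and> G n \<noteq> 0) \<and>
      (\<exists>h. h \<noteq> 0 \<and> G n dvd h \<and> h * G (Suc n) = 0 \<and> G n dvd G (Suc n))"
    by (elim exE) (rule that, elim allE)
  have G: "\<And>n. f dvd G n" "\<And>n. G n dvd G (Suc n)"
    and "\<And>n. \<exists>h. h \<noteq> 0 \<and> G n dvd h \<and> h * G (Suc n) = 0"
    using GG by blast+
  then obtain h where h: "\<And>n. h n \<noteq> 0" "\<And>n. G n dvd h n" "\<And>n. h n * G (Suc n) = 0" by metis
  have Gmono: "G m dvd G n" if "m \<le> n" for m n
    using that by (induction n rule: dec_induct) (auto intro: dvd_trans G)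
  have less: "(h m * a) * (h n * b) = 0" if "m < n" for m n a b
  proof -
    have "G (Suc m) dvd h n" using Gmono[of "Suc m" n] that h(2) dvd_trans by (metis Suc_leI)
    then obtain c where "h n = G (Suc m) * c" by (elim dvdE)
    then have "(h m * a) * (h n * b) = (h m * G (Suc m)) * (a * c * b)" by (simp add: ac_simps)
    then show ?thesis by (simp add: h)
  qed
  have "\<exists>a. norm (h n * a) \<le> 1 \<and> 4 ^ n \<le> norm (T (h n * a))" for n
    using mult_unbounded_witness[OF lin unbdd] h G dvd_trans by metis
  then obtain a where a: "\<And>n. norm (h n * a n) \<le> 1" "\<And>n. 4 ^ n \<le> norm (T (h n * a n))" by metis
  have "(h m * a m) * (h n * a n) = 0" if "m \<noteq> n" for m n
    using less[of m n "a m" "a n"] less[of n m "a n" "a m"] that by (metis mult.commute nat_neq_iff)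
  then obtain n where "norm (T (h n * a n)) < 4 ^ n"
    using orthogonal_sequence_bounded[OF lin sep, of "\<lambda>n. h n * a n"] a(1) by blast
  with a(2)[of n] show False by simp
qed

section \<open>Bounded separating maps are balanced\<close>

text \<open>
  The tent function of height and half-width one centred at the integer \<open>i\<close>.
\<close>

definition hat :: "real \<Rightarrow> int \<Rightarrow> real" where
  "hat s i = max 0 (1 - \<bar>s - of_int i\<bar>)"

text \<open>
  At most two tents are nonzero at \<open>s\<close>, so the sum is the linear interpolation of \<open>f\<close> between the
  neighbouring integers. Only the cases \<open>f = 1\<close> and \<open>f = of_int\<close> are of interest, where interpolation
  is exact.
\<close>

lemma sum_hat:
  fixes f :: "int \<Rightarrow> real"
  assumes "\<bar>s\<bar> \<le> of_int m"
  shows "(\<Sum>i\<in>{- m - 1..m + 1}. f i * hat s i) = f \<lfloor>s\<rfloor> * (1 - frac s) + f (\<lfloor>s\<rfloor> + 1) * frac s"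
proof -
  have "hat s i = 0" if "i \<noteq> \<lfloor>s\<rfloor>" "i \<noteq> \<lfloor>s\<rfloor> + 1" for i
  proof -
    have "i \<le> \<lfloor>s\<rfloor> - 1 \<or> i \<ge> \<lfloor>s\<rfloor> + 2" using that by linarith
    then have "real_of_int i \<le> of_int \<lfloor>s\<rfloor> - 1 \<or> real_of_int i \<ge> of_int \<lfloor>s\<rfloor> + 2" by linarith
    then have "\<bar>s - of_int i\<bar> \<ge> 1" by linarith
    then show ?thesis by (simp add: hat_def)
  qed
  moreover have "{\<lfloor>s\<rfloor>, \<lfloor>s\<rfloor> + 1} \<subseteq> {- m - 1..m + 1}"
    using assms by (auto, linarith+)
  ultimately have "(\<Sum>i\<in>{- m - 1..m + 1}. f i * hat s i) = (\<Sum>i\<in>{\<lfloor>s\<rfloor>, \<lfloor>s\<rfloor> + 1}. f i * hat s i)"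
    by (intro sum.mono_neutral_right) auto
  moreover have "hat s \<lfloor>s\<rfloor> = 1 - frac s" "hat s (\<lfloor>s\<rfloor> + 1) = frac s"
    unfolding hat_def frac_def of_int_add of_int_1 by linarith+
  ultimately show ?thesis by simp
qed

text \<open>
  The residue of \<open>k\<close> modulo 3 among \<open>-1, 0, 1\<close>. It agrees with \<open>k\<close> for \<open>\<bar>k\<bar> \<le> 1\<close> and depends only on the
  residue class.
\<close>

definition step3 :: "int \<Rightarrow> real" where
  "step3 k = (if k mod 3 = 1 then 1 else if k mod 3 = 2 then -1 else 0)"

text \<open>
  Take tents \<open>E i\<close> of half-width \<open>1 / N\<close> in the variable \<open>u\<close>, so that \<open>1 = (\<Sum>i. E i)\<close> and \<open>N u = (\<Sum>i. i E i)\<close>. With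
  \<open>X i j = S (E i * a) * S (E j * b)\<close>, the difference of both sides times \<open>N\<close> is the sum of \<open>(i - j) X i j\<close>,
  and \<open>X i j = 0\<close> unless \<open>\<bar>i - j\<bar> \<le> 1\<close>. The number of remaining terms grows with \<open>N\<close>, but \<open>i - j\<close> may now be
  replaced by its residue modulo 3. Then the sum collapses to nine products built from the partial sums
  \<open>F c\<close> of the tents with \<open>i mod 3 = c\<close>, which have norm at most one. The difference is thus \<open>O(1 / N)\<close>.
\<close>

lemma bounded_separating_balanced:
  fixes S :: "'a::unital_comm_real_cstar_algebra \<Rightarrow> 'b::unital_comm_real_cstar_algebra"
  assumes lin: "linear S" and bdd: "\<And>a. norm (S a) \<le> K * norm a"
    and sep: "\<And>a b. a * b = 0 \<Longrightarrow> S a * S b = 0" and u: "star u = u"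
  shows "S (u * a) * S b = S a * S (u * b)"
proof -
  interpret S: linear S by (rule lin)
  define D where "D = S (u * a) * S b - S a * S (u * b)"
  define B where "B = (\<bar>K\<bar> * norm a) * (\<bar>K\<bar> * norm b)"
  have "norm D * real N \<le> 9 * B" for N
  proof -
    \<comment> \<open>Indices beyond \<open>m + 1\<close> in absolute value have tents vanishing on the spectrum of \<open>N u\<close>.\<close>
    define m where "m = \<lceil>real N * norm u\<rceil>"
    define I where "I = {- m - 1..m + 1}"
    define E where "E i = cfc (\<lambda>t. hat (real N * t) i) u" for i
    have cont: "continuous_on A (\<lambda>t. hat (real N * t) i)" for A i
      unfolding hat_def by (intro continuous_intros)
    have bound: "\<bar>real N * t\<bar> \<le> of_int m" if "\<bar>t\<bar> \<le> norm u" for t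
    proof -
      have "\<bar>real N * t\<bar> \<le> real N * norm u" using that by (simp add: abs_mult mult_left_mono)
      then show ?thesis unfolding m_def by linarith
    qed
    have one: "(\<Sum>i\<in>I. hat (real N * t) i) = 1" if "\<bar>t\<bar> \<le> norm u" for t
      using sum_hat[OF bound[OF that], of "\<lambda>_. 1"] by (simp add: I_def)
    have ident: "(\<Sum>i\<in>I. of_int i * hat (real N * t) i) = real N * t" if "\<bar>t\<bar> \<le> norm u" for t
      using sum_hat[OF bound[OF that], of of_int] by (simp add: I_def algebra_simps frac_def)
    have E_sum: "(\<Sum>i\<in>I. E i) = 1"
    proof -
      have "(\<Sum>i\<in>I. E i) = cfc (\<lambda>t. \<Sum>i\<in>I. hat (real N * t) i) u"
        unfolding E_def by (intro cfc_sum[OF u, symmetric] cont)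
      also have "\<dots> = cfc (\<lambda>_. 1) u" by (intro cfc_cong[OF u] one)
      finally show ?thesis by (simp add: cfc_const[OF u])
    qed
    have E_ident: "(\<Sum>i\<in>I. of_int i *\<^sub>R E i) = real N *\<^sub>R u"
    proof -
      have "(\<Sum>i\<in>I. of_int i *\<^sub>R E i) = (\<Sum>i\<in>I. cfc (\<lambda>t. of_int i * hat (real N * t) i) u)"
        unfolding E_def by (intro sum.cong refl cfc_cmult[OF u, symmetric] cont)
      also have "\<dots> = cfc (\<lambda>t. \<Sum>i\<in>I. of_int i * hat (real N * t) i) u"
        by (intro cfc_sum[OF u, symmetric] continuous_on_mult continuous_on_const cont)
      also have "\<dots> = cfc (\<lambda>t. real N * t) u" by (intro cfc_cong[OF u] ident)
      also have "\<dots> = real N *\<^sub>R u"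
        by (subst cfc_cmult[OF u]) (auto intro: continuous_intros simp: cfc_id[OF u])
      finally show ?thesis .
    qed
    have E_orth: "E i * E j = 0" if "\<bar>i - j\<bar> \<ge> 2" for i j
    proof -
      have "(\<lambda>t. hat (real N * t) i * hat (real N * t) j) = (\<lambda>_. 0)"
      proof
        fix t
        have "\<bar>real_of_int i - of_int j\<bar> \<ge> 2" using that by linarith
        then have "\<bar>real N * t - of_int i\<bar> \<ge> 1 \<or> \<bar>real N * t - of_int j\<bar> \<ge> 1" by linarith
        then show "hat (real N * t) i * hat (real N * t) j = 0" by (auto simp: hat_def)
      qed
      then have "cfc (\<lambda>t. hat (real N * t) i * hat (real N * t) j) u = 0"
        by (simp only:) (simp add: cfc_const[OF u])
      then show ?thesis
        using cfc_mult[OF u cont cont, of i j] by (simp add: E_def)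
    qed
    have E_norm: "norm (\<Sum>i\<in>J. E i) \<le> 1" if J: "J \<subseteq> I" for J
    proof -
      have "(\<Sum>i\<in>J. E i) = cfc (\<lambda>t. \<Sum>i\<in>J. hat (real N * t) i) u"
        unfolding E_def by (intro cfc_sum[OF u, symmetric] cont)
      moreover have "norm (cfc (\<lambda>t. \<Sum>i\<in>J. hat (real N * t) i) u) \<le> 1"
      proof (rule norm_cfc_le[OF u])
        show "continuous_on {- norm u..norm u} (\<lambda>t. \<Sum>i\<in>J. hat (real N * t) i)"
          by (intro continuous_on_sum cont)
        fix t assume t: "\<bar>t\<bar> \<le> norm u"
        have "(\<Sum>i\<in>J. hat (real N * t) i) \<le> (\<Sum>i\<in>I. hat (real N * t) i)"
          by (rule sum_mono2) (auto simp: I_def hat_def J[unfolded I_def])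
        moreover have "(\<Sum>i\<in>J. hat (real N * t) i) \<ge> 0" by (intro sum_nonneg) (simp add: hat_def)
        ultimately show "\<bar>\<Sum>i\<in>J. hat (real N * t) i\<bar> \<le> 1" using one[OF t] by simp
      qed
      ultimately show ?thesis by simp
    qed
    define X where "X i j = S (E i * a) * S (E j * b)" for i j
    define F where "F c = (\<Sum>i\<in>{i \<in> I. i mod 3 = c}. E i)" for c
    have fin: "finite I" by (simp add: I_def)
    have group: "(\<Sum>i\<in>I. h i) = (\<Sum>c\<in>{0..2}. \<Sum>i\<in>{i \<in> I. i mod 3 = c}. h i)" for h :: "int \<Rightarrow> 'b"
      by (rule sum.group[symmetric]) (auto simp: fin)
    have S_sum: "S ((\<Sum>i\<in>J. s i *\<^sub>R E i) * c) = (\<Sum>i\<in>J. s i *\<^sub>R S (E i * c))" for J c s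
      by (simp add: sum_distrib_right S.sum S.scaleR)
    have SX: "S ((\<Sum>i\<in>J. s i *\<^sub>R E i) * a) * S ((\<Sum>j\<in>L. t j *\<^sub>R E j) * b)
        = (\<Sum>i\<in>J. \<Sum>j\<in>L. (s i * t j) *\<^sub>R X i j)" for J L s t
      unfolding S_sum sum_product by (simp add: X_def mult.commute)
    have "real N *\<^sub>R D = S ((real N *\<^sub>R u) * a) * S (1 * b) - S (1 * a) * S ((real N *\<^sub>R u) * b)"
      by (simp add: D_def S.scaleR scaleR_diff_right)
    also have "\<dots> = (\<Sum>i\<in>I. \<Sum>j\<in>I. (of_int i * 1) *\<^sub>R X i j) - (\<Sum>i\<in>I. \<Sum>j\<in>I. (1 * of_int j) *\<^sub>R X i j)"
      unfolding SX[symmetric] E_ident[symmetric] by (simp add: E_sum)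
    also have "\<dots> = (\<Sum>i\<in>I. \<Sum>j\<in>I. of_int (i - j) *\<^sub>R X i j)"
      by (simp add: sum_subtractf scaleR_diff_left)
    also have "\<dots> = (\<Sum>i\<in>I. \<Sum>j\<in>I. step3 (i - j) *\<^sub>R X i j)"
    proof (intro sum.cong refl)
      fix i j
      show "of_int (i - j) *\<^sub>R X i j = step3 (i - j) *\<^sub>R X i j"
      proof (cases "\<bar>i - j\<bar> \<ge> 2")
        case True
        have "(E i * a) * (E j * b) = (E i * E j) * (a * b)" by (simp add: ac_simps)
        then have "X i j = 0" unfolding X_def by (intro sep) (simp add: E_orth[OF True])
        then show ?thesis by simp
      next
        case False
        then have "i - j = -1 \<or> i - j = 0 \<or> i - j = 1" by linarith
        then have "of_int (i - j) = step3 (i - j)" by (auto simp: step3_def)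
        then show ?thesis by simp
      qed
    qed
    also have "\<dots> = (\<Sum>c\<in>{0..2}. \<Sum>i\<in>{i \<in> I. i mod 3 = c}. \<Sum>d\<in>{0..2}. \<Sum>j\<in>{j \<in> I. j mod 3 = d}. step3 (i - j) *\<^sub>R X i j)"
      unfolding group by (rule refl)
    also have "\<dots> = (\<Sum>c\<in>{0..2}. \<Sum>i\<in>{i \<in> I. i mod 3 = c}. \<Sum>d\<in>{0..2}. \<Sum>j\<in>{j \<in> I. j mod 3 = d}. step3 (c - d) *\<^sub>R X i j)"
    proof (intro sum.cong refl)
      fix i j c d assume "i \<in> {i \<in> I. i mod 3 = c}" "j \<in> {j \<in> I. j mod 3 = d}"
      then have "(i - j) mod 3 = (c - d) mod 3" by (auto simp: mod_diff_eq)
      then show "step3 (i - j) *\<^sub>R X i j = step3 (c - d) *\<^sub>R X i j" by (simp add: step3_def)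
    qed
    also have "\<dots> = (\<Sum>c\<in>{0..2}. \<Sum>d\<in>{0..2}. \<Sum>i\<in>{i \<in> I. i mod 3 = c}. \<Sum>j\<in>{j \<in> I. j mod 3 = d}. step3 (c - d) *\<^sub>R X i j)"
      by (intro sum.cong refl sum.swap)
    also have "\<dots> = (\<Sum>c\<in>{0..2}. \<Sum>d\<in>{0..2}. step3 (c - d) *\<^sub>R (S (F c * a) * S (F d * b)))"
    proof (intro sum.cong refl)
      fix c d
      show "(\<Sum>i\<in>{i \<in> I. i mod 3 = c}. \<Sum>j\<in>{j \<in> I. j mod 3 = d}. step3 (c - d) *\<^sub>R X i j)
          = step3 (c - d) *\<^sub>R (S (F c * a) * S (F d * b))"
        using SX[where s="\<lambda>_. 1" and t="\<lambda>_. 1"] by (simp add: F_def scaleR_sum_right)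
    qed
    finally have "real N *\<^sub>R D = (\<Sum>c\<in>{0..2}. \<Sum>d\<in>{0..2}. step3 (c - d) *\<^sub>R (S (F c * a) * S (F d * b)))" .
    moreover have "norm (step3 (c - d) *\<^sub>R (S (F c * a) * S (F d * b))) \<le> B" for c d
    proof -
      have SF: "norm (S (F c * x)) \<le> \<bar>K\<bar> * norm x" for c x
      proof -
        have "norm (F c * x) \<le> norm (F c) * norm x" by (rule norm_mult_ineq)
        also have "\<dots> \<le> norm x" using E_norm[of "{i \<in> I. i mod 3 = c}"]
          by (intro mult_left_le_one_le) (auto simp: F_def)
        finally have "\<bar>K\<bar> * norm (F c * x) \<le> \<bar>K\<bar> * norm x" by (intro mult_left_mono) auto
        moreover have "K * norm (F c * x) \<le> \<bar>K\<bar> * norm (F c * x)" by (intro mult_right_mono) auto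
        ultimately show ?thesis using bdd[of "F c * x"] by linarith
      qed
      have "norm (S (F c * a) * S (F d * b)) \<le> norm (S (F c * a)) * norm (S (F d * b))"
        by (rule norm_mult_ineq)
      also have "\<dots> \<le> B" unfolding B_def by (intro mult_mono SF) auto
      finally have "norm (S (F c * a) * S (F d * b)) \<le> B" .
      moreover have "B \<ge> 0" by (simp add: B_def)
      ultimately show ?thesis by (simp add: step3_def)
    qed
    then have "norm (\<Sum>c\<in>{0..2::int}. \<Sum>d\<in>{0..2::int}. step3 (c - d) *\<^sub>R (S (F c * a) * S (F d * b)))
        \<le> (\<Sum>c\<in>{0..2::int}. \<Sum>d\<in>{0..2::int}. B)"
      by (intro sum_norm_le)
    ultimately have "norm (real N *\<^sub>R D) \<le> 9 * B" by simp
    then show ?thesis by (simp add: mult.commute)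
  qed
  then have "norm D = 0"
  proof -
    assume *: "\<And>N. norm D * real N \<le> 9 * B"
    show ?thesis
    proof (rule ccontr)
      assume "norm D \<noteq> 0"
      then have D: "norm D > 0" by simp
      obtain N where "9 * B < real N * norm D" using reals_Archimedean3[OF D] by blast
      with *[of N] show False by (simp add: mult.commute)
    qed
  qed
  then show ?thesis by (simp add: D_def)
qed

section \<open>Continuity of separating bijections\<close>

text \<open>
  The bounded separating map \<open>a \<mapsto> T (v * a)\<close> is balanced. The factor \<open>v\<close> can be dropped because \<open>v\<close> acts
  as a unit on \<open>u\<close>: the element \<open>d - v * d\<close> is orthogonal to \<open>u * c\<close>.
\<close>

lemma separating_balanced_local:
  fixes T :: "'a::unital_comm_real_cstar_algebra \<Rightarrow> 'b::unital_comm_real_cstar_algebra"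
  assumes lin: "linear T" and sep: "\<And>a b. a * b = 0 \<Longrightarrow> T a * T b = 0"
    and v: "mult_bounded T v" and uv: "u * v = u" and u: "star u = u"
  shows "T (u * f) * T g = T f * T (u * g)"
proof -
  interpret T: linear T by (rule lin)
  obtain K where K: "\<And>a. norm (T (v * a)) \<le> K * norm a"
    using v unfolding mult_bounded_def by blast
  have "linear (\<lambda>a. T (v * a))"
    by (rule linearI) (simp_all add: distrib_left T.add T.scaleR)
  moreover have "T (v * a) * T (v * b) = 0" if "a * b = 0" for a b
  proof (rule sep)
    have "v * a * (v * b) = v * v * (a * b)" by (simp add: ac_simps)
    then show "v * a * (v * b) = 0" by (simp add: that)
  qed
  ultimately have "T (v * (u * f)) * T (v * g) = T (v * f) * T (v * (u * g))"
    using K u by (intro bounded_separating_balanced[of "\<lambda>a. T (v * a)" K u f g]) auto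
  moreover have vu: "v * (u * c) = u * c" for c
    using uv by (metis mult.assoc mult.commute)
  moreover have cut: "T (u * c) * T (v * d) = T (u * c) * T d" for c d
  proof -
    have "(u * c) * (d - v * d) = (u * c) * d - (u * v) * (c * d)"
      by (simp add: right_diff_distrib ac_simps)
    then have "(u * c) * (d - v * d) = 0" by (simp add: uv ac_simps)
    then have "T (u * c) * T (d - v * d) = 0" by (rule sep)
    then show ?thesis by (simp add: T.diff right_diff_distrib)
  qed
  ultimately have "T (u * f) * T g = T (v * f) * T (u * g)" by simp
  also have "\<dots> = T f * T (u * g)" using cut[of g f] by (simp add: mult.commute)
  finally show ?thesis .
qed

text \<open>
  Apply to \<open>t\<close> the soft threshold function, which vanishes on \<open>[- e, e]\<close> and differs from the identity by
  at most \<open>e\<close>, to get \<open>u\<close>; and the function \<open>s\<^sup>2 / max (s\<^sup>2) (e\<^sup>2)\<close>, which is one outside \<open>[- e, e]\<close> and is divisible by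
  \<open>s\<close>, to get \<open>v\<close>. Divisibility puts \<open>v\<close> into the ideal of bounded multipliers.
\<close>

lemma mult_bounded_cutoff:
  fixes t :: "'a::unital_comm_real_cstar_algebra"
  assumes t: "star t = t" and bdd: "mult_bounded T t" and e: "e > 0"
  obtains u v where "star u = u" "mult_bounded T v" "u * v = u" "norm (t - u) \<le> e"
proof
  let ?c = "\<lambda>s. s - max (- e) (min e s)" and ?k = "\<lambda>s. s / max (s * s) (e * e)"
  have cc: "continuous_on A ?c" for A by (intro continuous_intros)
  have pos: "max (s * s) (e * e) > 0" for s using e by (simp add: less_max_iff_disj)
  have ck: "continuous_on A ?k" for A
    using pos by (intro continuous_intros) (metis less_irrefl)
  show "star (cfc ?c t) = cfc ?c t" by (rule star_cfc[OF t cc])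
  show "mult_bounded T (t * cfc ?k t)" by (rule mult_bounded_mult[OF bdd])
  have "?c s * (s * ?k s) = ?c s" for s
  proof (cases "\<bar>s\<bar> \<le> e")
    case True
    then have "?c s = 0" by auto
    then show ?thesis by simp
  next
    case False
    then have "e * e \<le> \<bar>s\<bar> * \<bar>s\<bar>" using e by (intro mult_mono) auto
    then have "s * ?k s = 1" using False e by (auto simp: max_absorb1)
    then show ?thesis by (simp only: mult_1_right)
  qed
  then have "cfc ?c t = cfc (\<lambda>s. ?c s * (s * ?k s)) t" by (simp only:)
  also have "\<dots> = cfc ?c t * cfc (\<lambda>s. s * ?k s) t"
    by (intro cfc_mult[OF t] cc continuous_on_mult continuous_on_id ck)
  also have "cfc (\<lambda>s. s * ?k s) t = t * cfc ?k t"
    by (subst cfc_mult[OF t continuous_on_id ck]) (simp add: cfc_id[OF t])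
  finally show "cfc ?c t * (t * cfc ?k t) = cfc ?c t" ..
  have "t - cfc ?c t = cfc (\<lambda>s. s - ?c s) t"
    by (subst cfc_diff[OF t continuous_on_id cc]) (simp add: cfc_id[OF t])
  also have "norm \<dots> \<le> e"
    by (rule norm_cfc_le[OF t]) (use e in \<open>auto intro!: continuous_intros\<close>)
  finally show "norm (t - cfc ?c t) \<le> e" .
qed

text \<open>
  Local balance transports \<open>T (f - a n) \<longlonglongrightarrow> 0\<close> to \<open>T (u * f) = 0\<close> for every self-adjoint \<open>u\<close> with a bounded
  multiplier \<open>v\<close> acting as a unit on it. Such \<open>u\<close> approximate \<open>star s * s\<close> for every bounded multiplier \<open>s\<close>,
  and a nonzero \<open>f\<close> is not annihilated by all of these.
\<close>

lemma separating_bijection_closed_graph: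
  fixes T :: "'a::unital_comm_real_cstar_algebra \<Rightarrow> 'b::unital_comm_real_cstar_algebra"
  assumes lin: "linear T" and bij: "bij T" and sep: "\<And>a b. a * b = 0 \<Longrightarrow> T a * T b = 0"
    and a: "a \<longlonglongrightarrow> 0" and Ta: "(\<lambda>n. T (a n)) \<longlonglongrightarrow> T f"
  shows "f = 0"
proof (rule ccontr)
  interpret T: linear T by (rule lin)
  assume "f \<noteq> 0"
  then obtain s where s: "mult_bounded T s" "s * f \<noteq> 0"
    using mult_bounded_essential[OF lin sep] by blast
  have kill: "u * f = 0" if u: "star u = u" and v: "mult_bounded T v" and uv: "u * v = u" for u v
  proof -
    have "mult_bounded T u" using mult_bounded_mult[OF v, of u] uv by (simp add: mult.commute)
    then obtain K where K: "\<And>c. norm (T (u * c)) \<le> K * norm c"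
      unfolding mult_bounded_def by blast
    have "(\<lambda>n. K * norm (a n)) \<longlonglongrightarrow> 0"
      by (rule tendsto_mult_right_zero[OF tendsto_norm_zero[OF a]])
    then have "(\<lambda>n. T (u * a n)) \<longlonglongrightarrow> 0"
      by (rule Lim_null_comparison[OF always_eventually, rotated]) (simp add: K)
    then have "(\<lambda>n. T (u * f) - T (u * a n)) \<longlonglongrightarrow> T (u * f) - 0"
      by (intro tendsto_intros)
    then have lim1: "(\<lambda>n. T (u * (f - a n))) \<longlonglongrightarrow> T (u * f)"
      by (simp add: right_diff_distrib T.diff)
    have "(\<lambda>n. T f - T (a n)) \<longlonglongrightarrow> T f - T f" by (intro tendsto_intros Ta)
    then have lim2: "(\<lambda>n. T (f - a n)) \<longlonglongrightarrow> 0" by (simp add: T.diff)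
    obtain g where g: "T g = 1" using bij_is_surj[OF bij] by (metis surjD)
    have "(\<lambda>n. T (u * (f - a n)) * T g) \<longlonglongrightarrow> T (u * f) * T g"
      by (intro tendsto_intros lim1)
    moreover have "(\<lambda>n. T (f - a n) * T (u * g)) \<longlonglongrightarrow> 0 * T (u * g)"
      by (intro tendsto_intros lim2)
    moreover have "T (u * (f - a n)) * T g = T (f - a n) * T (u * g)" for n
      by (rule separating_balanced_local[OF lin sep v uv u])
    ultimately have "T (u * f) * T g = 0"
      using LIMSEQ_unique by force
    then have "T (u * f) = T 0" by (simp add: g T.zero)
    then show ?thesis by (rule injD[OF bij_is_inj[OF bij]])
  qed
  define t where "t = star s * s"
  have t: "star t = t" by (simp add: t_def star_mult star_star)
  have tbdd: "mult_bounded T t"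
    using mult_bounded_mult[OF s(1), of "star s"] by (simp add: t_def mult.commute)
  have "norm (t * f) \<le> e" if e: "e > 0" for e
  proof -
    obtain u v where uv: "star u = u" "mult_bounded T v" "u * v = u" "norm (t - u) \<le> e / (norm f + 1)"
      using mult_bounded_cutoff[OF t tbdd, of "e / (norm f + 1)"] e
      by (auto simp: add_nonneg_pos)
    have "t * f = (t - u) * f" using kill[OF uv(1-3)] by (simp add: left_diff_distrib)
    then have "norm (t * f) \<le> norm (t - u) * norm f" by (simp add: norm_mult_ineq)
    also have "\<dots> \<le> e / (norm f + 1) * (norm f + 1)"
      using uv(4) e by (intro mult_mono) auto
    also have "\<dots> = e" by (simp add: add_nonneg_eq_0_iff)
    finally show ?thesis .
  qed
  then have "norm (t * f) \<le> 0" by (rule field_le_epsilon[of _ 0, simplified])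
  then have "star s * s * f = 0" by (simp add: t_def)
  then have "s * f = 0" by (rule star_mult_cancel)
  with s show False by simp
qed

theorem theorem3p5:
  fixes T :: "'a::unital_comm_real_cstar_algebra \<Rightarrow> 'b::unital_comm_real_cstar_algebra"
  assumes "linear T" and "bij T" and "orthogonality_preserving T"
  shows "continuous_on UNIV T"
proof -
  interpret T: linear T by (rule assms(1))
  have sep: "T a * T b = 0" if "a * b = 0" for a b
    using assms(3) that by (simp add: orthogonality_preserving_def orthogonal_elements_iff)
  have "bounded_linear T"
  proof (rule closed_graph_imp_bounded[OF assms(1)])
    fix X x y assume X: "X \<longlonglongrightarrow> x" and TX: "(\<lambda>n. T (X n)) \<longlonglongrightarrow> y"
    obtain z where z: "T z = y" using bij_is_surj[OF assms(2)] by (metis surjD)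
    have "(\<lambda>n. X n - x) \<longlonglongrightarrow> 0" using X by (simp add: LIM_zero)
    moreover have "(\<lambda>n. T (X n - x)) \<longlonglongrightarrow> T (z - x)"
      unfolding T.diff z by (intro tendsto_intros TX)
    ultimately have "z - x = 0"
      using separating_bijection_closed_graph[OF assms(1,2) sep] by blast
    then show "T x = y" using z by simp
  qed
  then show ?thesis by (rule linear_continuous_on)
qed

end
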